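(* Let $r\in\{0,1,2\}$ and let $k$ be an integer with $3\le k\le 400$, and $k\ge 4$ when $r=2$. Let $U_{k,r}$ be the unicyclic graph obtained from the tree $T_{3,k,k+r}$ by adding the edge $v_1a_{2,1}$, and let $\alpha_{k,r}=2k+r+6=\alpha(U_{k,r})$. Then: (1) Every log-concavity inequality for $I(U_{k,r};x)$ holds except the penultimate one; that is, writing $I(U_{k,r};x)=\sum_{j=0}^{\alpha_{k,r}} u_jx^j$, one has $u_j^2\ge u_{j-1}u_{j+1}$ for all $1\le j\le \alpha_{k,r}-2$, while the inequality fails for $j=\alpha_{k,r}-1$. (2) The polynomial $H_{k,r}(x)=G_k(x)F_{k+r}(x)$ is log-concave. (3) A mode of $H_{k,r}(x)$ is $\left\lfloor\frac{4k+2r+8}{3}\right\rfloor$. (4) A mode of $E_{k,r}(x)=x(1+2x)^{2k+r+3}$ is $\left\lfloor\frac{4k+2r+10}{3}\right\rfloor$. (5) A mode of $I(U_{k,r};x)$ is $\left\lfloor\frac{4k+2r+9}{3}\right\rfloor$.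
   Context: Graphs are finite and simple. $I(G;x)=\sum_{j=0}^{\alpha(G)}s_j(G)x^j$ is the independence polynomial, where $s_j(G)$ counts independent sets of size $j$ and $\alpha(G)$ is the independence number. A polynomial with nonnegative coefficients $(a_0,\dots,a_d)$ is log-concave if $a_i^2\ge a_{i-1}a_{i+1}$ for $1\le i\le d-1$. It is unimodal with a mode at $m$ if $a_0\le\cdots\le a_m\ge\cdots\ge a_d$. For integers $m,n\ge 0$, the tree $T_{3,m,n}$ has a root $v_0$ with exactly three children $v_1,v_2,v_3$. A $P_2$-arm at a vertex $v$ is a path $v\,a\,b$ with edges $va$, $ab$ and new vertices $a,b$. The vertex $v_1$ carries three $P_2$-arms $v_1a_{1,j}b_{1,j}$, $v_2$ carries $m$ $P_2$-arms $v_2a_{2,j}b_{2,j}$, and $v_3$ carries $n$ $P_2$-arms $v_3a_{3,j}b_{3,j}$. There are no other vertices or edges. For $t\ge 0$, $F_t(x)=(1+2x)^t+x(1+x)^t$; for $k\ge 1$, $G_k(x)=I(T_{3,k-1,0};x)=F_4(x)(1+2x)^{k-1}+x(1+x)^kF_3(x)$. *)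

theory Defs
  imports "HOL-Computational_Algebra.Polynomial"
begin

record 'v sgraph =
  verts :: "'v set"
  edges :: "'v set set"

definition simple_graph :: "'v sgraph \<Rightarrow> bool" where
  "simple_graph G \<longleftrightarrow> finite (verts G) \<and> (\<forall>e\<in>edges G. e \<subseteq> verts G \<and> card e = 2)"

definition add_edge :: "'v sgraph \<Rightarrow> 'v \<Rightarrow> 'v \<Rightarrow> 'v sgraph" where
  "add_edge G u v = G\<lparr>edges := insert {u, v} (edges G)\<rparr>"

definition independent_set :: "'v sgraph \<Rightarrow> 'v set \<Rightarrow> bool" where
  "independent_set G S \<longleftrightarrow> S \<subseteq> verts G \<and> (\<forall>u\<in>S. \<forall>v\<in>S. {u, v} \<notin> edges G)"

definition independence_number :: "'v sgraph \<Rightarrow> nat" where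
  "independence_number G = Max (card ` {S. independent_set G S})"

definition num_independent_sets :: "'v sgraph \<Rightarrow> nat \<Rightarrow> nat" where
  "num_independent_sets G j = card {S. independent_set G S \<and> card S = j}"

definition independence_poly :: "'v sgraph \<Rightarrow> int poly" where
  "independence_poly G =
     (\<Sum>j\<le>independence_number G. monom (int (num_independent_sets G j)) j)"

text \<open>Index \<open>i\<close> is only meaningful for \<open>i \<ge> 1\<close>, since the subtraction is truncated.\<close>

definition log_concave_at :: "int poly \<Rightarrow> nat \<Rightarrow> bool" where
  "log_concave_at p i \<longleftrightarrow> coeff p (i - 1) * coeff p (i + 1) \<le> (coeff p i)\<^sup>2"

definition log_concave :: "int poly \<Rightarrow> bool" where
  "log_concave p \<longleftrightarrow> (\<forall>i. 0 \<le> coeff p i) \<and>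
     (\<forall>i. 1 \<le> i \<and> i + 1 \<le> degree p \<longrightarrow> log_concave_at p i)"

text \<open>Having a mode at \<open>m\<close> includes being unimodal.  Modes need not be unique.\<close>

definition unimodal_with_mode :: "int poly \<Rightarrow> nat \<Rightarrow> bool" where
  "unimodal_with_mode p m \<longleftrightarrow> (\<forall>i. 0 \<le> coeff p i) \<and> m \<le> degree p \<and>
     (\<forall>i<m. coeff p i \<le> coeff p (i + 1)) \<and>
     (\<forall>i. m \<le> i \<and> i < degree p \<longrightarrow> coeff p (i + 1) \<le> coeff p i)"

text \<open>
  \<open>Root\<close> is $v_0$, \<open>Child i\<close> is $v_i$, and \<open>Arm_a i j\<close>, \<open>Arm_b i j\<close> are $a_{i,j}$, $b_{i,j}$.
  All indices start at 1.
\<close>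

datatype vertex = Root | Child nat | Arm_a nat nat | Arm_b nat nat

definition arms :: "nat \<Rightarrow> nat \<Rightarrow> nat \<Rightarrow> nat" where
  "arms m n i = (if i = 1 then 3 else if i = 2 then m else if i = 3 then n else 0)"

definition T3 :: "nat \<Rightarrow> nat \<Rightarrow> vertex sgraph" where
  "T3 m n = \<lparr>
     verts = {Root} \<union> {Child i |i. i \<in> {1..3}} \<union>
       {Arm_a i j |i j. i \<in> {1..3} \<and> j \<in> {1..arms m n i}} \<union>
       {Arm_b i j |i j. i \<in> {1..3} \<and> j \<in> {1..arms m n i}},
     edges = {{Root, Child i} |i. i \<in> {1..3}} \<union>
       {{Child i, Arm_a i j} |i j. i \<in> {1..3} \<and> j \<in> {1..arms m n i}} \<union>
       {{Arm_a i j, Arm_b i j} |i j. i \<in> {1..3} \<and> j \<in> {1..arms m n i}}\<rparr>"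

text \<open>The new edge joins two vertices of \<open>T3 k (k + r)\<close> only if \<open>k \<ge> 1\<close>.\<close>

definition U_graph :: "nat \<Rightarrow> nat \<Rightarrow> vertex sgraph" where
  "U_graph k r = add_edge (T3 k (k + r)) (Child 1) (Arm_a 2 1)"

definition F_poly :: "nat \<Rightarrow> int poly" where
  "F_poly t = [:1, 2:] ^ t + [:0, 1:] * [:1, 1:] ^ t"

text \<open>Used for \<open>k \<ge> 1\<close> only; the subtraction is truncated.\<close>

definition G_poly :: "nat \<Rightarrow> int poly" where
  "G_poly k = independence_poly (T3 (k - 1) 0)"

definition H_poly :: "nat \<Rightarrow> nat \<Rightarrow> int poly" where
  "H_poly k r = G_poly k * F_poly (k + r)"

definition E_poly :: "nat \<Rightarrow> nat \<Rightarrow> int poly" where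
  "E_poly k r = [:0, 1:] * [:1, 2:] ^ (2 * k + r + 3)"

lemma simple_graph_T3: "simple_graph (T3 m n)"
proof -
  have 1: "finite {Arm_a i j |i j. i \<in> {1..3} \<and> j \<in> {1..arms m n i}}"
    by (rule finite_subset[of _ "(\<lambda>(i, j). Arm_a i j) ` (SIGMA i:{1..3}. {1..arms m n i})"]) auto
  have 2: "finite {Arm_b i j |i j. i \<in> {1..3} \<and> j \<in> {1..arms m n i}}"
    by (rule finite_subset[of _ "(\<lambda>(i, j). Arm_b i j) ` (SIGMA i:{1..3}. {1..arms m n i})"]) auto
  show ?thesis
    using 1 2 by (auto simp: simple_graph_def T3_def)
qed

lemma simple_graph_U_graph:
  assumes "k \<ge> 1"
  shows "simple_graph (U_graph k r)"
  using simple_graph_T3[of k "k + r"] assms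
  by (auto simp: simple_graph_def U_graph_def add_edge_def T3_def arms_def)

end

theory Submission
  imports Defs
begin

text \<open>
  Conditioning on \<open>v_0\<close> and on \<open>a_{2,1}\<close> gives \<open>I(U) = H + E\<close>. Put \<open>N = 2 k + r - 1\<close>. Expanding the
  factors of \<open>H\<close> by \<open>F_t = (1 + 2 x)^t + x (1 + x)^t\<close>, both \<open>H\<close> and \<open>I(U)\<close> become a main term
  \<open>P (1 + 2 x)^N\<close> with \<open>P\<close> of degree 5, plus one and the same rest \<open>W\<close>, all of whose terms contain
  about \<open>k\<close> factors \<open>1 + x\<close>. Both polynomials \<open>P\<close> are ultra-log-concave, a property that survives
  multiplication by \<open>1 + 2 x\<close>; this leaves the main term a margin \<open>1 + 1/j\<close> in its \<open>j\<close>-th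
  inequality. From \<open>k\<close> to \<open>k + 1\<close> the main term is multiplied by \<open>1 + 4 x + 4 x^2\<close> and \<open>W\<close> at most by
  \<open>1 + 3 x + 2 x^2\<close>, so that \<open>6 (6/5)^j W_j \<le> p_j\<close>, once true, remains true for all larger \<open>k\<close>.
  For \<open>k \<ge> 24\<close> the rest is then within the margin, and also too small to move the mode, which for the
  main term is found from polynomial inequalities in \<open>N\<close>. The base case \<open>k = 24\<close> and the cases
  \<open>3 \<le> k < 24\<close> are computed with lists of integers.
\<close>

subsection \<open>Independence polynomials by vertex deletion\<close>

text \<open>Sums do not preserve log-concavity, so a merely log-concave main term would leave no
  room for \<open>W\<close>; the binomial factor in ultra-log-concavity supplies a quantitative
  margin. The weight \<open>6/5\<close> has to exceed 1, so that the relative size of the rest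
  decays in \<open>j\<close> faster than the margin \<open>1/j\<close>. It also has to satisfy
  \<open>3 * 6/5 < 4\<close> and \<open>2 * 36/25 < 4\<close>, so that the passage from
  \<open>k\<close> to \<open>k + 1\<close> leaves slack.

  The obstacle is the upper end. The main term stops at degree \<open>n = 2 k + r + 4\<close>, two
  below the degree of \<open>W\<close>. There the slack must pay for the missing main coefficients,
  and the last inequalities need exact leading coefficients. At \<open>n + 1\<close> the coefficient
  \<open>a 2^N\<close>, with \<open>a\<close> the leading coefficient of \<open>P\<close>, competes
  with the square of about \<open>2^(k - 1) + 2^(k + r)\<close>. Both are of order
  \<open>4^k\<close>, so constants decide: \<open>a = 1\<close> gives the inequality for
  \<open>H\<close>, while \<open>a = 17\<close> makes it fail for \<open>I(U)\<close> as long as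
  \<open>r <= 2\<close>. The additional 16 comes from \<open>E\<close>, which reaches degree
  \<open>n\<close> only.\<close>

definition indep_family :: "'v set set \<Rightarrow> 'v set \<Rightarrow> 'v set set" where
  "indep_family E V = {S. S \<subseteq> V \<and> (\<forall>u\<in>S. \<forall>v\<in>S. {u, v} \<notin> E)}"

text \<open>Deleting vertices shrinks only \<open>V\<close>, so all induced subgraphs share one edge
  set \<open>E\<close>. Since \<open>indep_family\<close> admits \<open>u = v\<close>, a member
  \<open>{v}\<close> of \<open>E\<close> would act as a loop; hence the hypotheses that exclude
  it.\<close>

definition indep_poly_on :: "'v set set \<Rightarrow> 'v set \<Rightarrow> int poly" where
  "indep_poly_on E V = (\<Sum>S\<in>indep_family E V. monom 1 (card S))"

lemma finite_indep_family: "finite V \<Longrightarrow> finite (indep_family E V)"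
  by (rule finite_subset[of _ "Pow V"]) (auto simp: indep_family_def)

lemma coeff_indep_poly_on:
  assumes "finite V"
  shows "coeff (indep_poly_on E V) j = int (card {S \<in> indep_family E V. card S = j})"
proof -
  have "coeff (indep_poly_on E V) j = (\<Sum>S\<in>indep_family E V. if card S = j then 1 else 0)"
    by (simp add: indep_poly_on_def coeff_sum)
  also have "\<dots> = int (card {S \<in> indep_family E V. card S = j})"
    using finite_indep_family[OF assms] by (simp add: sum.If_cases Int_def)
  finally show ?thesis .
qed

text \<open>The coefficient at the largest size of an independent set counts at least one set and
  all later ones count none, so the truncated sum is the whole polynomial.\<close>

lemma independence_number_and_poly:
  assumes "finite (verts G)"
  shows "independence_number G = degree (indep_poly_on (edges G) (verts G))"
    and "independence_poly G = indep_poly_on (edges G) (verts G)"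
proof -
  let ?P = "indep_poly_on (edges G) (verts G)"
  have fam: "{S. independent_set G S} = indep_family (edges G) (verts G)"
    by (auto simp: independent_set_def indep_family_def)
  let ?I = "indep_family (edges G) (verts G)"
  have fin: "finite (card ` ?I)" using finite_indep_family[OF assms] by simp
  have ne: "card ` ?I \<noteq> {}" by (auto simp: indep_family_def intro: exI[of _ "{}"])
  have al: "independence_number G = Max (card ` ?I)" by (simp add: independence_number_def fam)
  have num: "int (num_independent_sets G j) = coeff ?P j" for j
    using fam by (simp add: num_independent_sets_def coeff_indep_poly_on[OF assms] set_eq_iff)
  have zero: "coeff ?P j = 0" if "j > Max (card ` ?I)" for j
  proof -
    have "{S \<in> ?I. card S = j} = {}" using that Max_ge[OF fin] by fastforce
    then show ?thesis using coeff_indep_poly_on[OF assms, of "edges G" j] by (metis card.empty of_nat_0)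
  qed
  have "Max (card ` ?I) \<in> card ` ?I" by (rule Max_in[OF fin ne])
  then have "{S \<in> ?I. card S = Max (card ` ?I)} \<noteq> {}" by auto
  then have nz: "coeff ?P (Max (card ` ?I)) \<noteq> 0"
    using finite_indep_family[OF assms] by (simp add: coeff_indep_poly_on[OF assms])
  have "degree ?P = Max (card ` ?I)"
    using nz zero by (intro antisym degree_le le_degree) auto
  then show "independence_number G = degree ?P" by (simp add: al)
  then show "independence_poly G = ?P"
    by (simp add: independence_poly_def num poly_as_sum_of_monoms)
qed

lemma indep_poly_on_cong:
  assumes "\<And>u v. u \<in> V \<Longrightarrow> v \<in> V \<Longrightarrow> {u, v} \<in> E \<longleftrightarrow> {u, v} \<in> E'"
  shows "indep_poly_on E V = indep_poly_on E' V"
proof -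
  have "indep_family E V = indep_family E' V"
    unfolding indep_family_def using assms by (intro Collect_cong conj_cong refl ball_cong) auto
  then show ?thesis by (simp add: indep_poly_on_def)
qed

lemma indep_poly_on_empty: "indep_poly_on E {} = 1"
proof -
  have "indep_family E {} = {{}}" by (auto simp: indep_family_def)
  then show ?thesis by (simp add: indep_poly_on_def)
qed

text \<open>Independent sets containing \<open>v\<close> arise by adding \<open>v\<close> to sets
  that avoid its neighbours, which costs a factor \<open>x\<close>.\<close>

lemma indep_poly_on_insert:
  assumes "finite V" "v \<notin> V" "{v} \<notin> E"
  shows "indep_poly_on E (insert v V) =
    indep_poly_on E V + [:0, 1:] * indep_poly_on E {u \<in> V. {v, u} \<notin> E}"
proof -
  let ?W = "{u \<in> V. {v, u} \<notin> E}"
  have fam: "indep_family E (insert v V) = indep_family E V \<union> insert v ` indep_family E ?W" (is "?L = ?R")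
  proof (intro equalityI subsetI)
    fix S assume S: "S \<in> ?L"
    show "S \<in> ?R"
    proof (cases "v \<in> S")
      case True
      then have "S = insert v (S - {v})" "S - {v} \<in> indep_family E ?W"
        using S assms by (auto simp: indep_family_def)
      then show ?thesis by blast
    next
      case False
      then show ?thesis using S by (auto simp: indep_family_def)
    qed
  next
    fix S assume "S \<in> ?R"
    then show "S \<in> ?L" using assms by (auto simp: indep_family_def insert_commute)
  qed
  have fin: "finite (indep_family E V)" "finite (indep_family E ?W)"
    using assms by (auto intro!: finite_indep_family)
  have vn: "v \<notin> S \<and> finite S" if "S \<in> indep_family E ?W" for S
    using that assms by (auto simp: indep_family_def intro: finite_subset)
  have disj: "indep_family E V \<inter> insert v ` indep_family E ?W = {}"
    using assms by (auto simp: indep_family_def)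
  have inj: "inj_on (insert v) (indep_family E ?W)"
    using vn by (auto simp: inj_on_def insert_ident)
  have "(\<Sum>S\<in>insert v ` indep_family E ?W. monom (1::int) (card S))
      = (\<Sum>S\<in>indep_family E ?W. [:0, 1:] * monom 1 (card S))"
    unfolding sum.reindex[OF inj] o_def
    by (intro sum.cong refl) (simp add: vn monom_Suc)
  then show ?thesis
    by (simp add: indep_poly_on_def fam sum.union_disjoint fin disj sum_distrib_left)
qed

text \<open>The induction is over proper subsets rather than single insertions, because the
  recursion at \<open>v\<close> also meets \<open>V1\<close> without all neighbours of
  \<open>v\<close>.\<close>

lemma indep_poly_on_Un:
  assumes "finite V1" "finite V2" "V1 \<inter> V2 = {}"
    and "\<And>v. v \<in> V1 \<Longrightarrow> {v} \<notin> E"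
    and "\<And>u v. u \<in> V1 \<Longrightarrow> v \<in> V2 \<Longrightarrow> {u, v} \<notin> E"
  shows "indep_poly_on E (V1 \<union> V2) = indep_poly_on E V1 * indep_poly_on E V2"
  using assms(1,3-5)
proof (induction V1 rule: finite_psubset_induct)
  case (psubset V1)
  show ?case
  proof (cases "V1 = {}")
    case True
    then show ?thesis by (simp add: indep_poly_on_empty)
  next
    case False
    then obtain v where v: "v \<in> V1" by blast
    let ?V = "V1 - {v}" and ?W = "{u \<in> V1 - {v}. {v, u} \<notin> E}"
    have V1: "V1 = insert v ?V" using v by blast
    have vv: "{v} \<notin> E" using psubset.prems(2) v by blast
    have filter: "{u \<in> ?V \<union> V2. {v, u} \<notin> E} = ?W \<union> V2"
      using psubset.prems(1) psubset.prems(3)[OF v] by blast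
    have IH1: "indep_poly_on E (?V \<union> V2) = indep_poly_on E ?V * indep_poly_on E V2"
      by (rule psubset.IH) (use v psubset.prems in auto)
    have IH2: "indep_poly_on E (?W \<union> V2) = indep_poly_on E ?W * indep_poly_on E V2"
      by (rule psubset.IH) (use v psubset.prems in auto)
    have "indep_poly_on E (V1 \<union> V2) = indep_poly_on E (insert v (?V \<union> V2))"
      by (rule arg_cong[of _ _ "indep_poly_on E"]) (use v in blast)
    also have "\<dots> = indep_poly_on E (?V \<union> V2) + [:0, 1:] * indep_poly_on E {u \<in> ?V \<union> V2. {v, u} \<notin> E}"
      by (rule indep_poly_on_insert) (use v psubset assms(2) vv in auto)
    also have "\<dots> = (indep_poly_on E ?V + [:0, 1:] * indep_poly_on E ?W) * indep_poly_on E V2"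
      unfolding filter IH1 IH2 by (simp add: algebra_simps)
    also have "indep_poly_on E ?V + [:0, 1:] * indep_poly_on E ?W = indep_poly_on E V1"
      by (subst V1, rule indep_poly_on_insert[symmetric]) (use psubset vv in auto)
    finally show ?thesis .
  qed
qed

section \<open>The tree and the unicyclic graph\<close>

lemma edges_T3_iff:
  "{Root, Child i} \<in> edges (T3 m n) \<longleftrightarrow> i \<in> {1..3}"
  "{Child i, Root} \<in> edges (T3 m n) \<longleftrightarrow> i \<in> {1..3}"
  "{Child i, Arm_a i' j} \<in> edges (T3 m n) \<longleftrightarrow> i' = i \<and> i \<in> {1..3} \<and> j \<in> {1..arms m n i}"
  "{Arm_a i' j, Child i} \<in> edges (T3 m n) \<longleftrightarrow> i' = i \<and> i \<in> {1..3} \<and> j \<in> {1..arms m n i}"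
  "{Arm_a i j, Arm_b i' j'} \<in> edges (T3 m n) \<longleftrightarrow> i' = i \<and> j' = j \<and> i \<in> {1..3} \<and> j \<in> {1..arms m n i}"
  "{Arm_b i' j', Arm_a i j} \<in> edges (T3 m n) \<longleftrightarrow> i' = i \<and> j' = j \<and> i \<in> {1..3} \<and> j \<in> {1..arms m n i}"
  "{Root, Arm_a i j} \<notin> edges (T3 m n)" "{Arm_a i j, Root} \<notin> edges (T3 m n)"
  "{Root, Arm_b i j} \<notin> edges (T3 m n)" "{Arm_b i j, Root} \<notin> edges (T3 m n)"
  "{Child i, Child i'} \<notin> edges (T3 m n)"
  "{Child i, Arm_b i' j} \<notin> edges (T3 m n)" "{Arm_b i' j, Child i} \<notin> edges (T3 m n)"
  "{Arm_a i j, Arm_a i' j'} \<notin> edges (T3 m n)"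
  "{Arm_b i j, Arm_b i' j'} \<notin> edges (T3 m n)"
  "{v} \<notin> edges (T3 m n)"
  by (auto simp: T3_def doubleton_eq_iff)

definition arm_set :: "nat \<Rightarrow> nat set \<Rightarrow> vertex set" where
  "arm_set i J = Arm_a i ` J \<union> Arm_b i ` J"

lemma finite_arm_set: "finite J \<Longrightarrow> finite (arm_set i J)"
  by (simp add: arm_set_def)

text \<open>Stated for an edge set that agrees with \<open>T3\<close> on the arms at one child, so that it
  also covers the graph with the additional edge.\<close>

lemma indep_poly_on_arm_set:
  assumes "finite J"
    and aa: "\<And>j j'. {Arm_a i j, Arm_a i j'} \<notin> E" and bb: "\<And>j j'. {Arm_b i j, Arm_b i j'} \<notin> E"
    and ab: "\<And>j j'. {Arm_a i j, Arm_b i j'} \<in> E \<longleftrightarrow> j' = j \<and> j \<in> J'" and J: "J \<subseteq> J'"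
  shows "indep_poly_on E (arm_set i J) = [:1, 2:] ^ card J"
    and "indep_poly_on E (Arm_b i ` J) = [:1, 1:] ^ card J"
proof -
  have ba: "{Arm_b i j, Arm_a i j'} \<in> E \<longleftrightarrow> j' = j \<and> j \<in> J'" for j j'
    using ab[of j' j] by (auto simp: insert_commute)
  have a: "{Arm_a i j} \<notin> E" and b: "{Arm_b i j} \<notin> E" for j
    using aa[of j j] bb[of j j] by auto
  show "indep_poly_on E (arm_set i J) = [:1, 2:] ^ card J"
    using assms(1) J
  proof (induction J)
    case empty
    then show ?case by (simp add: arm_set_def indep_poly_on_empty)
  next
    case (insert j J)
    have two: "indep_poly_on E {Arm_a i j, Arm_b i j} = [:1, 2:]"
    proof -
      have "{u \<in> {Arm_b i j}. {Arm_a i j, u} \<notin> E} = {}" using ab insert by auto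
      moreover have "{u \<in> {}. {Arm_b i j, u} \<notin> E} = {}" by simp
      ultimately show ?thesis
        using indep_poly_on_insert[of "{Arm_b i j}" "Arm_a i j" E] indep_poly_on_insert[of "{}" "Arm_b i j" E]
        by (simp only:) (simp add: a b indep_poly_on_empty one_pCons)
    qed
    have "arm_set i (insert j J) = {Arm_a i j, Arm_b i j} \<union> arm_set i J" by (auto simp: arm_set_def)
    also have "indep_poly_on E \<dots> = indep_poly_on E {Arm_a i j, Arm_b i j} * indep_poly_on E (arm_set i J)"
      by (rule indep_poly_on_Un) (use insert aa bb ab ba in \<open>auto simp: arm_set_def a b\<close>)
    finally show ?case using insert two by simp
  qed
  show "indep_poly_on E (Arm_b i ` J) = [:1, 1:] ^ card J"
    using assms(1) 
  proof (induction J)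
    case (insert j J)
    have "{u \<in> Arm_b i ` J. {Arm_b i j, u} \<notin> E} = Arm_b i ` J" using bb by auto
    then have "indep_poly_on E (insert (Arm_b i j) (Arm_b i ` J)) =
        indep_poly_on E (Arm_b i ` J) + [:0, 1:] * indep_poly_on E (Arm_b i ` J)"
      using insert b indep_poly_on_insert[of "Arm_b i ` J" "Arm_b i j" E] by auto
    also have "\<dots> = [:1, 1:] * indep_poly_on E (Arm_b i ` J)" by simp
    finally have "indep_poly_on E (Arm_b i ` insert j J) = [:1, 1:] * indep_poly_on E (Arm_b i ` J)"
      by simp
    then show ?case using insert by simp
  qed (simp add: indep_poly_on_empty)
qed

text \<open>Without the centre the arms are disjoint edges; with it only their outer vertices
  remain. \<open>J\<close> may be smaller than \<open>J'\<close>, as happens at \<open>v_2\<close>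
  once the arm through \<open>a_{2,1}\<close> is split off.\<close>

lemma indep_poly_on_star:
  assumes "finite J"
    and "\<And>j j'. {Arm_a i j, Arm_a i j'} \<notin> E" "\<And>j j'. {Arm_b i j, Arm_b i j'} \<notin> E"
    and "\<And>j j'. {Arm_a i j, Arm_b i j'} \<in> E \<longleftrightarrow> j' = j \<and> j \<in> J'" "J \<subseteq> J'"
    and "\<And>j. {Child i, Arm_a i j} \<in> E \<longleftrightarrow> j \<in> J'" "\<And>j. {Child i, Arm_b i j} \<notin> E" "{Child i} \<notin> E"
  shows "indep_poly_on E (insert (Child i) (arm_set i J)) = F_poly (card J)"
proof -
  have "{u \<in> arm_set i J. {Child i, u} \<notin> E} = Arm_b i ` J"
    using assms(5-7) by (auto simp: arm_set_def)
  then show ?thesis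
    using indep_poly_on_insert[of "arm_set i J" "Child i" E] assms(1,8)
    by (simp only: indep_poly_on_arm_set[OF assms(1-5)] F_poly_def finite_arm_set) (auto simp: arm_set_def)
qed

lemma verts_T3:
  "verts (T3 m n) = insert Root (insert (Child 1) (arm_set 1 {1..3}) \<union>
     (insert (Child 2) (arm_set 2 {1..m}) \<union> insert (Child 3) (arm_set 3 {1..n})))"
proof -
  have i: "i \<in> {1..3} \<longleftrightarrow> i = 1 \<or> i = 2 \<or> i = 3" for i :: nat by auto
  have "v \<in> verts (T3 m n) \<longleftrightarrow> v \<in> insert Root (insert (Child 1) (arm_set 1 {1..3}) \<union>
     (insert (Child 2) (arm_set 2 {1..m}) \<union> insert (Child 3) (arm_set 3 {1..n})))" for v
    unfolding T3_def i by (cases v) (auto simp: arm_set_def arms_def)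
  then show ?thesis by blast
qed

lemma indep_poly_T3:
  "indep_poly_on (edges (T3 m n)) (verts (T3 m n)) =
     F_poly 3 * (F_poly m * F_poly n) + [:0, 1:] * [:1, 2:] ^ (3 + m + n)"
proof -
  let ?E = "edges (T3 m n)"
  let ?S1 = "insert (Child 1) (arm_set 1 {1..3})"
  let ?S2 = "insert (Child 2) (arm_set 2 {1..m})"
  let ?S3 = "insert (Child 3) (arm_set 3 {1..n})"
  have arm: "indep_poly_on ?E (arm_set i {1..arms m n i}) = [:1, 2:] ^ arms m n i"
    and star: "indep_poly_on ?E (insert (Child i) (arm_set i {1..arms m n i})) = F_poly (arms m n i)"
    if "i \<in> {1..3}" for i
    using that
      indep_poly_on_arm_set(1)[of "{1..arms m n i}" i ?E "{1..arms m n i}"]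
      indep_poly_on_star[of "{1..arms m n i}" i ?E "{1..arms m n i}"]
    by (auto simp: edges_T3_iff)
  note [simp del] = One_nat_def
  have nb: "{u \<in> ?S1 \<union> (?S2 \<union> ?S3). {Root, u} \<notin> ?E}
     = arm_set 1 {1..3} \<union> (arm_set 2 {1..m} \<union> arm_set 3 {1..n})"
    by (auto simp: arm_set_def edges_T3_iff)
  have out: "indep_poly_on ?E (?S1 \<union> (?S2 \<union> ?S3)) = F_poly 3 * (F_poly m * F_poly n)"
  proof -
    have "indep_poly_on ?E (?S1 \<union> (?S2 \<union> ?S3)) = indep_poly_on ?E ?S1 * indep_poly_on ?E (?S2 \<union> ?S3)"
      by (rule indep_poly_on_Un) (auto simp: arm_set_def edges_T3_iff)
    also have "indep_poly_on ?E (?S2 \<union> ?S3) = indep_poly_on ?E ?S2 * indep_poly_on ?E ?S3"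
      by (rule indep_poly_on_Un) (auto simp: arm_set_def edges_T3_iff)
    finally show ?thesis using star[of 1] star[of 2] star[of 3] by (simp add: arms_def)
  qed
  have "in": "indep_poly_on ?E (arm_set 1 {1..3} \<union> (arm_set 2 {1..m} \<union> arm_set 3 {1..n}))
     = [:1, 2:] ^ (3 + m + n)" (is "indep_poly_on ?E (?A1 \<union> (?A2 \<union> ?A3)) = _")
  proof -
    have "indep_poly_on ?E (?A1 \<union> (?A2 \<union> ?A3)) = indep_poly_on ?E ?A1 * indep_poly_on ?E (?A2 \<union> ?A3)"
      by (rule indep_poly_on_Un) (auto simp: arm_set_def edges_T3_iff)
    also have "indep_poly_on ?E (?A2 \<union> ?A3) = indep_poly_on ?E ?A2 * indep_poly_on ?E ?A3"
      by (rule indep_poly_on_Un) (auto simp: arm_set_def edges_T3_iff)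
    finally show ?thesis using arm[of 1] arm[of 2] arm[of 3] by (simp add: arms_def power_add)
  qed
  have "indep_poly_on ?E (insert Root (?S1 \<union> (?S2 \<union> ?S3))) = indep_poly_on ?E (?S1 \<union> (?S2 \<union> ?S3)) +
      [:0, 1:] * indep_poly_on ?E {u \<in> ?S1 \<union> (?S2 \<union> ?S3). {Root, u} \<notin> ?E}"
    by (rule indep_poly_on_insert) (auto simp: edges_T3_iff arm_set_def)
  then show ?thesis unfolding verts_T3 nb out "in" .
qed

lemma edges_U: "edges (U_graph k r) = insert {Child 1, Arm_a 2 1} (edges (T3 k (k + r)))"
  by (simp add: U_graph_def add_edge_def)

lemma verts_U: "verts (U_graph k r) = verts (T3 k (k + r))"
  by (simp add: U_graph_def add_edge_def)

text \<open>Choosing \<open>v_0\<close> deletes \<open>v_1\<close>, so the new edge disappears and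
  disjoint edges remain: this is \<open>E\<close>. Without \<open>v_0\<close>, the star at
  \<open>v_3\<close> splits off and the other two stars hang together through
  \<open>a_{2,1}\<close>. Conditioning on that vertex reproduces \<open>G_k\<close>: its deletion
  isolates \<open>b_{2,1}\<close>, whose \<open>1 + x\<close> is \<open>F_0\<close>, and its choice
  deletes \<open>v_1\<close>, \<open>v_2\<close> and \<open>b_{2,1}\<close>, leaving
  \<open>k + 2\<close> disjoint edges, as the root of \<open>T3 (k - 1) 0\<close> does.\<close>

lemma indep_poly_U:
  assumes "k \<ge> 1"
  shows "indep_poly_on (edges (U_graph k r)) (verts (U_graph k r)) =
     (F_poly 3 * (F_poly (k - 1) * [:1, 1:]) + [:0, 1:] * [:1, 2:] ^ (k + 2)) * F_poly (k + r)
       + [:0, 1:] * [:1, 2:] ^ (2 * k + r + 3)"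
proof -
  note [simp del] = One_nat_def
  let ?E = "edges (U_graph k r)"
  let ?S1 = "insert (Child 1) (arm_set 1 {1..3})"
  let ?S2 = "insert (Child 2) (arm_set 2 {1..k})"
  let ?S2' = "insert (Child 2) (arm_set 2 {2..k})"
  let ?S3 = "insert (Child 3) (arm_set 3 {1..k + r})"
  note E = edges_U edges_T3_iff doubleton_eq_iff
  have arm: "indep_poly_on ?E (arm_set i J) = [:1, 2:] ^ card J"
    if "i \<in> {1..3}" "J \<subseteq> {1..arms k (k + r) i}" for i J
    by (rule indep_poly_on_arm_set(1)[of _ _ _ "{1..arms k (k + r) i}"])
      (use that finite_subset[OF that(2)] in \<open>auto simp: E\<close>)
  have star: "indep_poly_on ?E (insert (Child i) (arm_set i J)) = F_poly (card J)"
    if "i \<in> {1..3}" "J = {1..arms k (k + r) i} \<or> i = 2 \<and> J = {2..k}" for i J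
  proof -
    \<comment> \<open>The new edge joins two different stars, so inside one star the edges are those
      of the tree.\<close>
    have "indep_poly_on ?E (insert (Child i) (arm_set i J)) = indep_poly_on (edges (T3 k (k + r))) (insert (Child i) (arm_set i J))"
      by (rule indep_poly_on_cong) (auto simp: edges_U doubleton_eq_iff arm_set_def)
    also have "\<dots> = F_poly (card J)"
      by (rule indep_poly_on_star[of _ _ _ "{1..arms k (k + r) i}"])
        (use that in \<open>auto simp: edges_T3_iff arms_def\<close>)
    finally show ?thesis .
  qed
  have sgl: "indep_poly_on ?E {Arm_b 2 1} = [:1, 1:]"
    using indep_poly_on_arm_set(2)[of "{1}" 2 ?E "{1..k}"] assms by (auto simp: E arms_def)
  have "{1..k} = insert 1 {2..k}" using assms by auto
  then have a21: "?S1 \<union> ?S2 = insert (Arm_a 2 1) (?S1 \<union> (?S2' \<union> {Arm_b 2 1}))"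
    by (simp add: arm_set_def) blast
  have nb: "{u \<in> ?S1 \<union> (?S2' \<union> {Arm_b 2 1}). {Arm_a 2 1, u} \<notin> ?E} = arm_set 1 {1..3} \<union> arm_set 2 {2..k}"
    using assms by (auto simp: arm_set_def E arms_def)
  have o1: "indep_poly_on ?E (?S1 \<union> (?S2' \<union> {Arm_b 2 1})) = F_poly 3 * (F_poly (k - 1) * [:1, 1:])"
  proof -
    have "indep_poly_on ?E (?S1 \<union> (?S2' \<union> {Arm_b 2 1})) = indep_poly_on ?E ?S1 * indep_poly_on ?E (?S2' \<union> {Arm_b 2 1})"
      by (rule indep_poly_on_Un) (auto simp: arm_set_def E)
    also have "indep_poly_on ?E (?S2' \<union> {Arm_b 2 1}) = indep_poly_on ?E ?S2' * indep_poly_on ?E {Arm_b 2 1}"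
      by (rule indep_poly_on_Un) (auto simp: arm_set_def E)
    finally show ?thesis using star[of 1 "{1..3}"] star[of 2 "{2..k}"] sgl by (simp add: arms_def)
  qed
  have o2: "indep_poly_on ?E (arm_set 1 {1..3} \<union> arm_set 2 {2..k}) = [:1, 2:] ^ (k + 2)"
  proof -
    have "indep_poly_on ?E (arm_set 1 {1..3} \<union> arm_set 2 {2..k}) = indep_poly_on ?E (arm_set 1 {1..3}) * indep_poly_on ?E (arm_set 2 {2..k})"
      by (rule indep_poly_on_Un) (auto simp: arm_set_def E)
    also have "\<dots> = [:1, 2:] ^ 3 * [:1, 2:] ^ (k - 1)"
      using arm[of 1 "{1..3}"] arm[of 2 "{2..k}"] by (simp add: arms_def)
    also have "\<dots> = [:1, 2:] ^ (3 + (k - 1))" by (rule power_add[symmetric])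
    also have "3 + (k - 1) = k + 2" using assms by simp
    finally show ?thesis .
  qed
  have S12: "indep_poly_on ?E (?S1 \<union> ?S2) =
      F_poly 3 * (F_poly (k - 1) * [:1, 1:]) + [:0, 1:] * [:1, 2:] ^ (k + 2)"
    unfolding a21 o1[symmetric] o2[symmetric] nb[symmetric]
    by (rule indep_poly_on_insert) (auto simp: E arm_set_def)
  have out: "indep_poly_on ?E ((?S1 \<union> ?S2) \<union> ?S3) =
      (F_poly 3 * (F_poly (k - 1) * [:1, 1:]) + [:0, 1:] * [:1, 2:] ^ (k + 2)) * F_poly (k + r)"
  proof -
    have "indep_poly_on ?E ((?S1 \<union> ?S2) \<union> ?S3) = indep_poly_on ?E (?S1 \<union> ?S2) * indep_poly_on ?E ?S3"
      by (rule indep_poly_on_Un) (auto simp: arm_set_def E)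
    moreover have "indep_poly_on ?E ?S3 = F_poly (k + r)"
      using star[of 3 "{1..k+r}"] by (simp add: arms_def)
    ultimately show ?thesis unfolding S12 by (simp only:)
  qed
  have nbr: "{u \<in> (?S1 \<union> ?S2) \<union> ?S3. {Root, u} \<notin> ?E} = (arm_set 1 {1..3} \<union> arm_set 2 {1..k}) \<union> arm_set 3 {1..k + r}"
    by (auto simp: arm_set_def E)
  have "in": "indep_poly_on ?E ((arm_set 1 {1..3} \<union> arm_set 2 {1..k}) \<union> arm_set 3 {1..k + r})
     = [:1, 2:] ^ (2 * k + r + 3)" (is "indep_poly_on ?E ((?A1 \<union> ?A2) \<union> ?A3) = _")
  proof -
    have "indep_poly_on ?E ((?A1 \<union> ?A2) \<union> ?A3) = indep_poly_on ?E (?A1 \<union> ?A2) * indep_poly_on ?E ?A3"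
      by (rule indep_poly_on_Un) (auto simp: arm_set_def E)
    also have "indep_poly_on ?E (?A1 \<union> ?A2) = indep_poly_on ?E ?A1 * indep_poly_on ?E ?A2"
      by (rule indep_poly_on_Un) (auto simp: arm_set_def E)
    finally have "indep_poly_on ?E ((?A1 \<union> ?A2) \<union> ?A3) = [:1, 2:] ^ 3 * [:1, 2:] ^ k * [:1, 2:] ^ (k + r)"
      using arm[of 1 "{1..3}"] arm[of 2 "{1..k}"] arm[of 3 "{1..k+r}"] by (simp add: arms_def)
    then show ?thesis by (simp add: mult_2 algebra_simps flip: power_add)
  qed
  have V: "verts (U_graph k r) = insert Root ((?S1 \<union> ?S2) \<union> ?S3)"
    by (simp only: verts_U verts_T3 Un_assoc)
  have "indep_poly_on ?E (insert Root ((?S1 \<union> ?S2) \<union> ?S3)) = indep_poly_on ?E ((?S1 \<union> ?S2) \<union> ?S3) +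
      [:0, 1:] * indep_poly_on ?E {u \<in> (?S1 \<union> ?S2) \<union> ?S3. {Root, u} \<notin> ?E}"
    by (rule indep_poly_on_insert) (auto simp: E arm_set_def)
  then show ?thesis unfolding V out nbr "in" .
qed

subsection \<open>Main term and rest\<close>

definition nonneg_poly :: "int poly \<Rightarrow> bool" where
  "nonneg_poly p \<longleftrightarrow> (\<forall>i. 0 \<le> coeff p i)"

lemma nonneg_polyD: "nonneg_poly p \<Longrightarrow> 0 \<le> coeff p i"
  by (simp add: nonneg_poly_def)

lemma nonneg_poly_0 [simp]: "nonneg_poly 0" and nonneg_poly_1 [simp]: "nonneg_poly 1"
  by (simp_all add: nonneg_poly_def coeff_1)

lemma nonneg_poly_pCons [simp]: "nonneg_poly (pCons a p) \<longleftrightarrow> 0 \<le> a \<and> nonneg_poly p"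
proof -
  have "nonneg_poly (pCons a p) \<longleftrightarrow> 0 \<le> coeff (pCons a p) 0 \<and> (\<forall>i. 0 \<le> coeff (pCons a p) (Suc i))"
    unfolding nonneg_poly_def by (metis not0_implies_Suc)
  then show ?thesis by (simp add: nonneg_poly_def)
qed

lemma nonneg_poly_add: "nonneg_poly p \<Longrightarrow> nonneg_poly q \<Longrightarrow> nonneg_poly (p + q)"
  by (simp add: nonneg_poly_def)

lemma nonneg_poly_mult: "nonneg_poly p \<Longrightarrow> nonneg_poly q \<Longrightarrow> nonneg_poly (p * q)"
  by (simp add: nonneg_poly_def coeff_mult sum_nonneg)

lemma nonneg_poly_power: "nonneg_poly p \<Longrightarrow> nonneg_poly (p ^ n)"
  by (induction n) (simp_all add: nonneg_poly_mult)

lemma nonneg_F_poly: "nonneg_poly (F_poly t)"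
  by (simp add: F_poly_def nonneg_poly_add nonneg_poly_mult nonneg_poly_power)

definition F3 :: "int poly" where "F3 = [:1, 7, 15, 11, 1:]"
definition F4 :: "int poly" where "F4 = [:1, 9, 28, 38, 20, 1:]"
text \<open>This is \<open>F4 + x (1 + 2 x)^4\<close>: as \<open>E = x (1 + 2 x)^(N + 4)\<close>,
  the whole of \<open>E\<close> is absorbed into the main term.\<close>

definition FU :: "int poly" where "FU = [:1, 10, 36, 62, 52, 17:]"

text \<open>With \<open>y = 1 + x\<close> and \<open>z = 1 + 2 x\<close>, this is
  \<open>(F4 z^(k-1) + x y^k F3) (z^(k+r) + x y^(k+r))\<close> without the product of the two
  leading summands.\<close>

definition rest_poly :: "nat \<Rightarrow> nat \<Rightarrow> int poly" where
  "rest_poly k r = [:0, 1:] * [:1, 1:] ^ k * F3 * F_poly (k + r)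
     + [:0, 1:] * F4 * [:1, 2:] ^ (k - 1) * [:1, 1:] ^ (k + r)"

lemma F_poly_3: "F_poly 3 = F3"
  by (simp add: F_poly_def F3_def eval_nat_numeral one_pCons)

lemma F_poly_0: "F_poly 0 = [:1, 1:]"
  by (simp add: F_poly_def one_pCons)

lemma decomposition:
  assumes "k \<ge> 1"
  shows "(F_poly 3 * (F_poly (k - 1) * [:1, 1:]) + [:0, 1:] * [:1, 2:] ^ (k + 2)) * F_poly (k + r)
    = F4 * [:1, 2:] ^ (2 * k + r - 1) + rest_poly k r"
proof -
  from assms obtain l where k: "k = Suc l" by (cases k) auto
  define a b c d x y z :: "int poly"
    where "a = [:1, 2:] ^ l" and "b = [:1, 1:] ^ l" and "c = [:1, 2:] ^ (k + r)" and "d = [:1, 1:] ^ (k + r)"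
      and "x = [:0, 1:]" and "y = [:1, 1:]" and "z = [:1, 2:]"
  \<comment> \<open>This identity merges the two terms of \<open>G_k\<close> that carry
    \<open>a = z^(k-1)\<close> into one multiple of \<open>F4\<close>.\<close>
  have F4: "F4 = F3 * y + x * z ^ 3"
    by (simp add: F3_def F4_def x_def y_def z_def eval_nat_numeral one_pCons)
  have e1: "F_poly (k - 1) = a + x * b" by (simp add: F_poly_def k a_def b_def x_def)
  have e2: "F_poly (k + r) = c + x * d" by (simp add: F_poly_def c_def d_def x_def)
  have e3: "[:1, 2:] ^ (k + 2) = z ^ 3 * a" 
    unfolding a_def z_def k power_add[symmetric] by (rule arg_cong[of _ _ "power _"]) simp
  have e4: "[:1, 2:] ^ (2 * k + r - 1) = a * c" 
    unfolding a_def c_def k power_add[symmetric] by (rule arg_cong[of _ _ "power _"]) simp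
  have e5: "[:1, 1:] ^ k = y * b" by (simp add: k b_def y_def)
  have e6: "[:1, 2:] ^ (k - 1) = a" by (simp add: k a_def)
  have "(F3 * ((a + x * b) * y) + x * (z ^ 3 * a)) * (c + x * d) =
    (F3 * y + x * z ^ 3) * (a * c) + (x * (y * b) * F3 * (c + x * d) + x * (F3 * y + x * z ^ 3) * a * d)"
    by algebra
  then show ?thesis
    unfolding rest_poly_def F_poly_3 e1 e2 e3 e4 e5 e6 d_def[symmetric] F4
    unfolding x_def[symmetric] y_def[symmetric] z_def[symmetric] .
qed

lemma FU_eq: "FU = F4 + [:0, 1:] * [:1, 2:] ^ 4"
  by (simp add: FU_def F4_def eval_nat_numeral one_pCons)

lemma nonneg_rest_poly: "nonneg_poly (rest_poly k r)"
  unfolding rest_poly_def F3_def F4_def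
  by (intro nonneg_poly_add nonneg_poly_mult nonneg_poly_power nonneg_F_poly) auto

lemma F_poly_Suc: "F_poly (Suc t) + [:0, 1:] ^ 2 * [:1, 1:] ^ t = [:1, 2:] * F_poly t"
proof -
  have a: "[:1, 2:] = [:1, 1:] + [:0, 1 :: int:]" by simp
  show ?thesis unfolding F_poly_def power_Suc by (simp only: a) algebra
qed

text \<open>The second summand is multiplied exactly by \<open>(1 + x) (1 + 2 x)\<close>; the first
  loses the nonnegative \<open>D\<close>, because \<open>F_poly_Suc\<close> says that
  \<open>F_t\<close> gains a factor \<open>1 + 2 x\<close> up to a subtracted
  \<open>x^2 (1 + x)^t\<close>.\<close>

lemma rest_poly_Suc:
  assumes "k \<ge> 1"
  shows "coeff (rest_poly (Suc k) r) j \<le> coeff ([:1, 3, 2:] * rest_poly k r) j"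
proof -
  from assms obtain l where k: "k = Suc l" by (cases k) auto
  define D where "D = [:0, 1:] * ([:1, 1:] * [:1, 1:] ^ k) * F3 * ([:0, 1:] ^ 2 * [:1, 1:] ^ (k + r))"
  have alg: "y * z * (x * B * F3 * F + x * F4 * Z * D) =
      (x * (y * B) * F3 * G + x * F4 * (z * Z) * (y * D)) + x * (y * B) * F3 * (x ^ 2 * D)"
    if "G + x ^ 2 * D = z * F" for x y z B D Z F G :: "int poly"
    using that by algebra
  have m: "[:1, 3, 2:] = [:1, 1:] * [:1, 2 :: int:]" by simp
  have eq: "[:1, 3, 2:] * rest_poly k r = rest_poly (Suc k) r + D"
    using alg[OF F_poly_Suc[of "k + r"], of "[:1, 1:]" "[:1, 1:] ^ k" "[:1, 2:] ^ l"]
    unfolding rest_poly_def D_def m k diff_Suc_1 add_Suc by (simp only: power_Suc)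
  have "nonneg_poly D" unfolding D_def F3_def
    by (intro nonneg_poly_add nonneg_poly_mult nonneg_poly_power nonneg_F_poly) auto
  then show ?thesis unfolding eq by (simp add: nonneg_poly_def)
qed

section \<open>Leading coefficients\<close>

definition top1 :: "int poly \<Rightarrow> nat \<Rightarrow> int \<Rightarrow> bool" where
  "top1 p d a \<longleftrightarrow> degree p \<le> d \<and> coeff p d = a"

text \<open>The index \<open>d\<close> belongs to the second coefficient, the top one sits at
  \<open>Suc d\<close>; this keeps subtraction out of the indices.\<close>

definition top2 :: "int poly \<Rightarrow> nat \<Rightarrow> int \<Rightarrow> int \<Rightarrow> bool" where
  "top2 p d a b \<longleftrightarrow> degree p \<le> Suc d \<and> coeff p (Suc d) = a \<and> coeff p d = b"

lemma top1_mult: "top1 p d a \<Longrightarrow> top1 q e b \<Longrightarrow> top1 (p * q) (d + e) (a * b)"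
proof -
  assume p: "top1 p d a" and q: "top1 q e b"
  have deg: "degree (p * q) \<le> d + e"
    using degree_mult_le[of p q] p q by (simp add: top1_def)
  have "coeff (p * q) (d + e) = (\<Sum>i\<le>d + e. if i = d then a * b else 0)"
    unfolding coeff_mult
  proof (intro sum.cong refl)
    fix i assume "i \<in> {..d + e}"
    then consider "i < d" | "i = d" | "i > d" by linarith
    then show "coeff p i * coeff q (d + e - i) = (if i = d then a * b else 0)"
      using p q by cases (auto simp: top1_def coeff_eq_0)
  qed
  then show ?thesis using deg by (simp add: top1_def)
qed

lemma top2_mult: "top2 p d a b \<Longrightarrow> top2 q e a' b' \<Longrightarrow> top2 (p * q) (Suc (d + e)) (a * a') (a * b' + b * a')"
proof -
  assume p: "top2 p d a b" and q: "top2 q e a' b'"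
  have t: "top1 (p * q) (Suc d + Suc e) (a * a')"
    by (rule top1_mult) (use p q in \<open>auto simp: top1_def top2_def\<close>)
  have "coeff (p * q) (Suc (d + e)) = (\<Sum>i\<le>Suc (d + e). (if i = d then b * a' else 0) + (if i = Suc d then a * b' else 0))"
    unfolding coeff_mult
  proof (intro sum.cong refl)
    fix i assume "i \<in> {..Suc (d + e)}"
    then consider "i < d" | "i = d" | "i = Suc d" | "i > Suc d" by linarith
    then show "coeff p i * coeff q (Suc (d + e) - i) = (if i = d then b * a' else 0) + (if i = Suc d then a * b' else 0)"
      using p q by cases (auto simp: top2_def coeff_eq_0 Suc_diff_le)
  qed
  also have "\<dots> = a * b' + b * a'" by (simp add: sum.distrib)
  finally show ?thesis using t by (simp add: top1_def top2_def)
qed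

lemma top1_linear_power: "top1 ([:1, c:] ^ t) t (c ^ t)"
proof -
  have "degree ([:1, c:] ^ t) \<le> degree [:1, c:] * t" by (rule degree_power_le)
  also have "\<dots> \<le> t" by simp
  finally show ?thesis by (simp add: top1_def coeff_linear_poly_power)
qed

lemma top2_linear_power: "top2 ([:1, c:] ^ Suc t) t (c ^ Suc t) (int (Suc t) * c ^ t)"
proof -
  have "coeff ([:1, c:] ^ Suc t) t = int (Suc t) * c ^ t"
    by (simp add: coeff_linear_poly_power del: power_Suc)
  then show ?thesis using top1_linear_power[of c "Suc t"] by (simp only: top1_def top2_def)
qed

lemma top2_F_poly_Suc: "top2 (F_poly (Suc t)) (Suc t) 1 (2 ^ Suc t + int (Suc t))"
proof -
  have x: "top2 [:0, 1:] 0 1 0" by (simp add: top2_def)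
  have "top2 ([:0, 1:] * [:1, 1:] ^ Suc t) (Suc (0 + t)) (1 * 1 ^ Suc t) (1 * (int (Suc t) * 1 ^ t) + 0 * 1 ^ Suc t)"
    by (rule top2_mult[OF x top2_linear_power])
  moreover have "top1 ([:1, 2:] ^ Suc t) (Suc t) (2 ^ Suc t)" by (rule top1_linear_power)
  ultimately show ?thesis
    unfolding F_poly_def top1_def top2_def by (auto intro: degree_add_le simp del: power_Suc simp: coeff_eq_0)
qed

text \<open>The first summand is monic of the top degree, and its second coefficient adds those of
  its factors: \<open>k\<close>, 11 and \<open>2^(k+r) + k + r\<close>. The second summand ends one
  degree lower with leading coefficient \<open>2^(k-1)\<close>.\<close>

lemma top2_rest_poly:
  assumes "k \<ge> 1"
  shows "top2 (rest_poly k r) (2 * k + r + 5) 1 (2 ^ (k - 1) + 2 ^ (k + r) + int (2 * k + r + 11))"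
proof -
  from assms obtain l where k: "k = Suc l" by (cases k) auto
  have x: "top2 [:0, 1:] 0 1 0" by (simp add: top2_def)
  have F3: "top2 F3 3 1 11" by (simp add: top2_def F3_def eval_nat_numeral)
  have F4: "top1 F4 5 1" by (simp add: top1_def F4_def eval_nat_numeral)
  have "top2 ([:0, 1:] * [:1, 1:] ^ k * F3 * F_poly (k + r)) (2 * k + r + 5) 1
     (2 ^ (k + r) + int (2 * k + r + 11))"
    using top2_mult[OF top2_mult[OF top2_mult[OF x top2_linear_power[of 1 l]] F3] top2_F_poly_Suc[of "l + r"]]
    by (simp add: k algebra_simps del: power_Suc mult_pCons_left)
  moreover have "top1 ([:0, 1:] * F4 * [:1, 2:] ^ (k - 1) * [:1, 1:] ^ (k + r)) (2 * k + r + 5) (2 ^ (k - 1))"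
    using top1_mult[OF top1_mult[OF top1_mult[OF _ F4] top1_linear_power[of 2 l]] top1_linear_power[of 1 "k + r"], of "[:0,1:]" 1 1]
    by (simp add: top1_def k del: power_Suc mult_pCons_left)
  ultimately show ?thesis
    unfolding rest_poly_def top1_def top2_def
    by (auto intro: degree_add_le simp del: power_Suc mult_pCons_left simp: coeff_eq_0)
qed

section \<open>Domination of the rest by the main term\<close>

lemma coeff_quadratic_mult:
  fixes p :: "int poly"
  shows "coeff ([:a, b, c:] * p) (Suc (Suc i)) = a * coeff p (Suc (Suc i)) + b * coeff p (Suc i) + c * coeff p i"
  by simp

lemma coeff_rest_poly_0: "coeff (rest_poly k r) 0 = 0"
  by (simp add: rest_poly_def coeff_mult)

text \<open>The range stops at the degree of the main term; the two coefficients of the rest beyond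
  it are treated apart.\<close>

definition dominated :: "nat \<Rightarrow> nat \<Rightarrow> bool" where
  "dominated k r \<longleftrightarrow> (\<forall>j\<le>2 * k + r + 4.
     6 ^ Suc j * coeff (rest_poly k r) j \<le> 5 ^ j * coeff (F4 * [:1, 2:] ^ (2 * k + r - 1)) j)"

text \<open>What the step to \<open>k + 1\<close> demands of the two coefficients beyond the main
  term. In \<open>700 = 25 * 28\<close>, the 28 is the slack \<open>100 - 72\<close> on
  \<open>p0\<close> in \<open>dominated_step_arith\<close>, and the 25 comes from eliminating
  \<open>r\<close> by \<open>25 * 12^r <= 36 * 10^r\<close>.\<close>

lemma dominated_boundary:
  assumes "k \<ge> 24"
  shows "(6::int) ^ (2 * k + 9) * 2 ^ (k + 3) \<le> 700 * 5 ^ (2 * k + 4) * 2 ^ (2 * k - 1)"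
  using assms
proof (induction k rule: dec_induct)
  case base
  show ?case by simp
next
  case (step k)
  have "(6::int) ^ (2 * Suc k + 9) * 2 ^ (Suc k + 3) = 72 * (6 ^ (2 * k + 9) * 2 ^ (k + 3))"
    by (simp add: power_add)
  also have "\<dots> \<le> 72 * (700 * 5 ^ (2 * k + 4) * 2 ^ (2 * k - 1))" by (rule mult_left_mono[OF step.IH]) simp
  also have "\<dots> \<le> 100 * (700 * 5 ^ (2 * k + 4) * 2 ^ (2 * k - 1))" by (rule mult_right_mono) auto
  also have "\<dots> = 700 * 5 ^ (2 * Suc k + 4) * 2 ^ (2 * Suc k - 1)"
    using step by (cases k) (simp_all add: power_add)
  finally show ?case .
qed

lemma top1_main: "top1 P 5 a \<Longrightarrow> top1 (P * [:1, 2:] ^ N) (N + 5) (a * 2 ^ N)"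
  using top1_mult[of P 5 a "[:1, 2:] ^ N" N "2 ^ N"] top1_linear_power[of 2 N] by (simp add: add.commute)

text \<open>Of the available \<open>25 p2 + 100 p1 + 100 p0\<close> the three terms use
  \<open>25 p2 + 10 p1\<close>, \<open>90 p1\<close> and \<open>72 p0\<close>. The spare
  \<open>10 p1\<close> in the third hypothesis serves the index just above the main term, where
  \<open>p2 = 0\<close> but \<open>w2\<close> is not.\<close>

lemma dominated_step_arith:
  fixes A B w0 w1 w2 p0 p1 p2 :: int
  assumes "6 * (A * w0) \<le> B * p0" "36 * (A * w1) \<le> 5 * (B * p1)"
    and "216 * (A * w2) \<le> 25 * (B * p2) + 10 * (B * p1)" "0 \<le> B * p0"
  shows "216 * A * (w2 + 3 * w1 + 2 * w0) \<le> 25 * B * (p2 + 4 * p1 + 4 * p0)"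
proof -
  have "216 * A * (w2 + 3 * w1 + 2 * w0) = 216 * (A * w2) + 18 * (36 * (A * w1)) + 72 * (6 * (A * w0))"
    by (simp add: algebra_simps)
  also have "\<dots> \<le> (25 * (B * p2) + 10 * (B * p1)) + 18 * (5 * (B * p1)) + 72 * (B * p0)"
    using assms by (intro add_mono mult_left_mono) auto
  also have "\<dots> \<le> 25 * (B * p2) + 100 * (B * p1) + 100 * (B * p0)"
    using assms(4) by simp
  also have "\<dots> = 25 * B * (p2 + 4 * p1 + 4 * p0)" by (simp add: algebra_simps)
  finally show ?thesis .
qed

lemma dominated_Suc:
  assumes "dominated k r" "k \<ge> 24" "r \<le> 2"
  shows "dominated (Suc k) r"
  unfolding dominated_def
proof (intro allI impI)
  fix j assume j: "j \<le> 2 * Suc k + r + 4"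
  let ?W = "coeff (rest_poly k r)" and ?p = "coeff (F4 * [:1, 2:] ^ (2 * k + r - 1))"
  let ?n = "2 * k + r + 4"
  have dom: "6 ^ Suc i * ?W i \<le> 5 ^ i * ?p i" if "i \<le> ?n" for i
    using assms(1) that by (auto simp: dominated_def)
  have p0: "0 \<le> ?p i" for i
    by (rule nonneg_polyD, intro nonneg_poly_mult nonneg_poly_power) (auto simp: F4_def)
  have W0: "0 \<le> ?W i" for i by (rule nonneg_polyD[OF nonneg_rest_poly])
  have "2 * Suc k + r - 1 = 2 + (2 * k + r - 1)" using assms by simp
  then have "F4 * [:1, 2:] ^ (2 * Suc k + r - 1) = [:1, 2:] ^ 2 * (F4 * [:1, 2:] ^ (2 * k + r - 1))"
    by (simp only: power_add ac_simps)
  also have "[:1, 2:] ^ 2 = [:1, 4, 4::int:]" by (simp add: power2_eq_square)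
  finally have P: "F4 * [:1, 2:] ^ (2 * Suc k + r - 1) = [:1, 4, 4:] * (F4 * [:1, 2:] ^ (2 * k + r - 1))" .
  have W: "coeff (rest_poly (Suc k) r) j \<le> coeff ([:1, 3, 2:] * rest_poly k r) j"
    using assms by (intro rest_poly_Suc) simp
  have "top1 (F4 * [:1, 2:] ^ (2 * k + r - 1)) ((2 * k + r - 1) + 5) (1 * 2 ^ (2 * k + r - 1))"
    by (rule top1_main) (simp add: top1_def F4_def eval_nat_numeral)
  moreover have nn: "2 * k + r - 1 + 5 = ?n" using assms by simp
  ultimately have pn: "?p ?n = 2 ^ (2 * k + r - 1)" and pz: "\<And>i. i > ?n \<Longrightarrow> ?p i = 0"
    unfolding nn by (auto simp: top1_def intro: coeff_eq_0)
  have topW: "?W (Suc ?n) = 2 ^ (k - 1) + 2 ^ (k + r) + int (2 * k + r + 11)" "?W (Suc (Suc ?n)) = 1"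
    using top2_rest_poly[of k r] assms by (simp_all add: top2_def eval_nat_numeral)
  have arith: "1 + 3 * (a + b + c) \<le> d" if "c \<le> a" "e \<le> b" "e = 2 * a" "1 \<le> a" "d = 8 * b"
    for a b c d e :: int
    using that by (simp add: distrib_left)
  have "int (2 * k + r + 11) \<le> 2 ^ (k - 1)"
  proof -
    have "2 * k + 13 \<le> 2 ^ (k - 1)" using assms(2)
    proof (induction k rule: dec_induct)
      case (step k)
      then show ?case by (cases k) auto
    qed simp
    then have "int (2 * k + 13) \<le> int (2 ^ (k - 1))" by (rule of_nat_mono)
    then show ?thesis using assms(3) by simp
  qed
  moreover have "(2::int) ^ (k + r) \<ge> 2 ^ k" by simp
  moreover have "(2::int) ^ k = 2 * 2 ^ (k - 1)" using assms by (cases k) auto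
  moreover have "(1::int) \<le> 2 ^ (k - 1)" by simp
  moreover have "(2::int) ^ (k + r + 3) = 8 * 2 ^ (k + r)" by (simp add: power_add)
  ultimately have topb: "?W (Suc (Suc ?n)) + 3 * ?W (Suc ?n) \<le> 2 ^ (k + r + 3)"
    unfolding topW using arith by blast
  have bd: "6 ^ (?n + 3) * (?W (Suc (Suc ?n)) + 3 * ?W (Suc ?n)) \<le> 28 * 5 ^ ?n * ?p ?n"
  proof -
    \<comment> \<open>Equality holds at \<open>r = 2\<close>.\<close>
    have r: "25 * (6 ^ r * 2 ^ r) \<le> (36::int) * (5 ^ r * 2 ^ r)"
      using assms(3) by (auto simp: numeral_2_eq_2 le_Suc_eq)
    have "25 * (6 ^ (?n + 3) * (?W (Suc (Suc ?n)) + 3 * ?W (Suc ?n))) \<le> 25 * (6 ^ (?n + 3) * 2 ^ (k + r + 3))"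
      using topb by simp
    also have "\<dots> = 6 ^ (2 * k + 7) * 2 ^ (k + 3) * (25 * (6 ^ r * 2 ^ r))" by (simp add: power_add)
    also have "\<dots> \<le> 6 ^ (2 * k + 7) * 2 ^ (k + 3) * (36 * (5 ^ r * 2 ^ r))"
      by (intro mult_left_mono r) auto
    also have "\<dots> = 6 ^ (2 * k + 9) * 2 ^ (k + 3) * (5 ^ r * 2 ^ r)" by (simp add: power_add)
    also have "\<dots> \<le> 700 * 5 ^ (2 * k + 4) * 2 ^ (2 * k - 1) * (5 ^ r * 2 ^ r)"
      by (intro mult_right_mono dominated_boundary assms) auto
    also have "\<dots> = 25 * (28 * 5 ^ ?n * 2 ^ (2 * k - 1 + r))" by (simp add: power_add)
    also have "2 * k - 1 + r = 2 * k + r - 1" using assms by simp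
    finally show ?thesis by (simp only: pn)
  qed
  consider "j = 0" | "j = 1" | i where "j = Suc (Suc i)"
    by (metis One_nat_def not0_implies_Suc)
  then show "6 ^ Suc j * coeff (rest_poly (Suc k) r) j \<le> 5 ^ j * coeff (F4 * [:1, 2:] ^ (2 * Suc k + r - 1)) j"
  proof cases
    case 1
    then show ?thesis using p0[of 0] unfolding P by (simp add: coeff_rest_poly_0)
  next
    case 2
    have "coeff (rest_poly (Suc k) r) 1 \<le> ?W 1"
      using W unfolding 2 by (simp add: coeff_rest_poly_0)
    then have "36 * coeff (rest_poly (Suc k) r) 1 \<le> 5 * ?p 1"
      using dom[of 1] by simp
    also have "\<dots> \<le> 5 * (?p 1 + 4 * ?p 0)" using p0[of 0] by simp
    finally show ?thesis unfolding P 2 by simp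
  next
    case (3 i)
    note coeffs = coeff_quadratic_mult[of _ _ _ _ i]
    have "6 ^ Suc j * coeff (rest_poly (Suc k) r) j \<le> 6 ^ Suc j * (?W (Suc (Suc i)) + 3 * ?W (Suc i) + 2 * ?W i)"
      using W unfolding 3 coeffs by simp
    also have "\<dots> \<le> 5 ^ j * (?p (Suc (Suc i)) + 4 * ?p (Suc i) + 4 * ?p i)"
    proof -
      have i: "6 ^ Suc i * ?W i \<le> 5 ^ i * ?p i" using j 3 by (intro dom) simp
      have "j \<le> Suc (Suc ?n)" using j by simp
      then consider "j \<le> ?n" | "j = Suc ?n" | "j = Suc (Suc ?n)" by (auto simp only: le_Suc_eq)
      then show ?thesis
      proof cases
        case 1
        have "6 ^ Suc (Suc i) * ?W (Suc i) \<le> 5 ^ Suc i * ?p (Suc i)"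
          "6 ^ Suc (Suc (Suc i)) * ?W (Suc (Suc i)) \<le> 5 ^ Suc (Suc i) * ?p (Suc (Suc i))"
          using 1 3 dom[of "Suc i"] dom[of "Suc (Suc i)"] by (simp_all only: Suc_leD)
        moreover from this(2) have "216 * (6 ^ i * ?W (Suc (Suc i))) \<le> 25 * (5 ^ i * ?p (Suc (Suc i))) + 10 * (5 ^ i * ?p (Suc i))"
          using p0[of "Suc i"] by (simp add: mult.assoc add_increasing2)
        ultimately show ?thesis
          using dominated_step_arith[of "6 ^ i" "?W i" "5 ^ i" "?p i" "?W (Suc i)" "?p (Suc i)"
              "?W (Suc (Suc i))" "?p (Suc (Suc i))"] i p0[of i] p0[of "Suc i"]
          by (simp add: 3 mult.assoc)
      next
        case 2
        then have i': "?n = Suc i" using 3 by simp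
        have "6 ^ Suc (Suc i) * ?W (Suc i) \<le> 5 ^ Suc i * ?p (Suc i)"
          unfolding i'[symmetric] by (intro dom) simp
        moreover have "?p (Suc (Suc i)) = 0" using i' by (intro pz) simp
        moreover have "216 * (6 ^ i * ?W (Suc (Suc i))) \<le> 10 * (5 ^ i * ?p (Suc i))"
        proof -
          have "6 ^ (Suc i + 3) * (3 * ?W (Suc (Suc i)))
              \<le> 6 ^ (Suc i + 3) * (?W (Suc (Suc (Suc i))) + 3 * ?W (Suc (Suc i)))"
            using W0 by simp
          also note bd[unfolded i']
          \<comment> \<open>Since \<open>3888 = 18 * 216\<close> and \<open>140 < 18 * 10\<close>,
            the spare 10 suffices.\<close>
          finally have "3888 * (6 ^ i * ?W (Suc (Suc i))) \<le> 140 * (5 ^ i * ?p (Suc i))"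
            by (simp add: power_add)
          moreover have "0 \<le> 5 ^ i * ?p (Suc i)" using p0 by simp
          ultimately show ?thesis by linarith
        qed
        ultimately show ?thesis
          using dominated_step_arith[of "6 ^ i" "?W i" "5 ^ i" "?p i" "?W (Suc i)" "?p (Suc i)"
              "?W (Suc (Suc i))" "?p (Suc (Suc i))"] i p0[of i]
          by (simp add: 3 mult.assoc)
      next
        case j: 3
        then have i': "?n = i" using 3 by simp
        \<comment> \<open>Only \<open>100 p0\<close> is left to pay: 72 goes to \<open>?W i\<close>
          and 28 to the two coefficients above.\<close>
        have pp: "?p (Suc i) = 0" "?p (Suc (Suc i)) = 0"
          by (rule pz, simp add: i'[symmetric])+
        have "6 ^ Suc j * (?W (Suc (Suc i)) + 3 * ?W (Suc i) + 2 * ?W i) =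
            6 ^ (i + 3) * (?W (Suc (Suc i)) + 3 * ?W (Suc i)) + 72 * (6 ^ Suc i * ?W i)"
          by (simp add: 3 power_add algebra_simps)
        also have "\<dots> \<le> 28 * 5 ^ i * ?p i + 72 * (5 ^ i * ?p i)"
          using bd[unfolded i'] i by (intro add_mono mult_left_mono) auto
        also have "\<dots> = 5 ^ j * (?p (Suc (Suc i)) + 4 * ?p (Suc i) + 4 * ?p i)"
          unfolding 3 pp by simp
        finally show ?thesis .
      qed
    qed
    also have "\<dots> = 5 ^ j * coeff (F4 * [:1, 2:] ^ (2 * Suc k + r - 1)) j"
      unfolding P 3 coeffs by simp
    finally show ?thesis .
  qed
qed

subsection \<open>Ultra-log-concavity\<close>

text \<open>The witness \<open>q\<close> is the sequence divided by the binomials. The last conjunct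
  also forces \<open>a\<close> to vanish beyond \<open>n\<close>.\<close>

definition ultra_log_concave :: "nat \<Rightarrow> (nat \<Rightarrow> real) \<Rightarrow> bool" where
  "ultra_log_concave n a \<longleftrightarrow> (\<exists>q. (\<forall>j\<le>n. 0 < q j) \<and>
     (\<forall>j. 1 \<le> j \<and> j < n \<longrightarrow> q (j - 1) * q (j + 1) \<le> (q j)\<^sup>2) \<and>
     (\<forall>j. a j = real (n choose j) * q j))"

text \<open>Here \<open>a\<close>, \<open>b\<close>, \<open>c\<close>, \<open>d\<close> are the
  values of \<open>q\<close> at \<open>j - 2\<close> to \<open>j + 1\<close>, and
  \<open>s = n + 1 - j\<close>. Inserting \<open>b d <= c^2\<close>, \<open>a c <= b^2\<close> and
  their consequence \<open>a d <= b c\<close> leaves exactly the square \<open>(c - 2 b)^2\<close>.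
  The alternatives \<open>s = 1\<close> and \<open>j = 1\<close> are the ends of the range, where
  \<open>d\<close> or \<open>a\<close> lies outside but has coefficient zero.\<close>

lemma ultra_log_concave_linear_arith:
  fixes a b c d s j :: real
  assumes "j \<ge> 1" "s \<ge> 1" "0 < b" "0 < c"
    and bd: "s = 1 \<or> b * d \<le> c\<^sup>2" and ac: "j = 1 \<or> (0 < a \<and> a * c \<le> b\<^sup>2)" and d: "s = 1 \<or> 0 < d"
  shows "((s + 1) * b + 2 * (j - 1) * a) * ((s - 1) * d + 2 * (j + 1) * c) \<le> (s * c + 2 * j * b)\<^sup>2"
proof -
  have ad: "a * d \<le> b * c" if "j \<noteq> 1" "s \<noteq> 1"
  proof -
    have h: "b * d \<le> c\<^sup>2" "0 < a" "a * c \<le> b\<^sup>2" "0 < d" using that bd ac d by auto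
    have "(a * d) * (b * c) = (a * c) * (b * d)" by simp
    also have "\<dots> \<le> b\<^sup>2 * c\<^sup>2"
      using h assms(3,4) by (intro mult_mono) auto
    also have "\<dots> = (b * c) * (b * c)" by (simp add: power2_eq_square)
    finally show ?thesis using assms(3,4) by (simp add: mult_le_cancel_right)
  qed
  have 1: "(s + 1) * (s - 1) * (b * d) \<le> (s + 1) * (s - 1) * c\<^sup>2"
    using bd assms by (cases "s = 1") (auto intro!: mult_left_mono)
  have 2: "4 * (j - 1) * (j + 1) * (a * c) \<le> 4 * (j - 1) * (j + 1) * b\<^sup>2"
    using ac assms by (cases "j = 1") (auto intro!: mult_left_mono)
  have 3: "2 * (j - 1) * (s - 1) * (a * d) \<le> 2 * (j - 1) * (s - 1) * (b * c)"
  proof (cases "j = 1 \<or> s = 1")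
    case False
    then show ?thesis using ad assms(1,2) by (intro mult_left_mono) auto
  qed auto
  have "((s + 1) * b + 2 * (j - 1) * a) * ((s - 1) * d + 2 * (j + 1) * c) =
      (s + 1) * (s - 1) * (b * d) + 4 * (j - 1) * (j + 1) * (a * c) + 2 * (j - 1) * (s - 1) * (a * d)
      + 2 * (s + 1) * (j + 1) * (b * c)"
    by (simp add: algebra_simps)
  also have "\<dots> \<le> (s + 1) * (s - 1) * c\<^sup>2 + 4 * (j - 1) * (j + 1) * b\<^sup>2 + 2 * (j - 1) * (s - 1) * (b * c)
      + 2 * (s + 1) * (j + 1) * (b * c) + (c - 2 * b)\<^sup>2"
    using add_mono[OF add_mono[OF 1 2] 3] zero_le_power2[of "c - 2 * b"] by linarith
  also have "\<dots> = (s * c + 2 * j * b)\<^sup>2"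
    by (simp add: power2_eq_square algebra_simps)
  finally show ?thesis .
qed

text \<open>The case of one linear factor of Liggett's theorem on products of ultra-log-concave
  sequences. The new quotients \<open>q' j / M\<close> come from writing \<open>n choose j\<close>
  and \<open>n choose (j - 1)\<close> as multiples of \<open>Suc n choose j\<close>.\<close>

lemma ultra_log_concave_linear:
  assumes "ultra_log_concave n a"
  shows "ultra_log_concave (Suc n) (\<lambda>j. a j + 2 * (if j = 0 then 0 else a (j - 1)))"
proof -
  obtain q where pos: "\<And>j. j \<le> n \<Longrightarrow> 0 < q j"
    and lc: "\<And>j. 1 \<le> j \<Longrightarrow> j < n \<Longrightarrow> q (j - 1) * q (j + 1) \<le> (q j)\<^sup>2"
    and a: "\<And>j. a j = real (n choose j) * q j"
    using assms by (auto simp: ultra_log_concave_def)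
  define M where "M = real (Suc n)"
  define q' where "q' j = (M - real j) * q j + 2 * real j * q (j - 1)" for j
  have M: "M > 0" by (simp add: M_def)
  have pos': "0 < q' j" if "j \<le> Suc n" for j
  proof (cases "j = Suc n")
    case True
    then show ?thesis using pos[of n] by (simp add: q'_def M_def)
  next
    case False
    then show ?thesis using pos[of j] less_imp_le[OF pos[of "j - 1"]] that
      by (auto simp: q'_def M_def intro!: add_pos_nonneg mult_pos_pos mult_nonneg_nonneg)
  qed
  have lc': "q' (j - 1) * q' (j + 1) \<le> (q' j)\<^sup>2" if j: "1 \<le> j" "j < Suc n" for j
  proof -
    have "((M - j + 1) * q (j - 1) + 2 * (real j - 1) * q (j - 2)) * ((M - j - 1) * q (j + 1) + 2 * (real j + 1) * q j)
       \<le> ((M - j) * q j + 2 * real j * q (j - 1))\<^sup>2"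
    proof (rule ultra_log_concave_linear_arith)
      show "M - j = 1 \<or> q (j - 1) * q (j + 1) \<le> (q j)\<^sup>2"
        using lc[of j] j by (cases "j = n") (auto simp: M_def)
      show "real j = 1 \<or> 0 < q (j - 2) \<and> q (j - 2) * q j \<le> (q (j - 1))\<^sup>2"
        using lc[of "j - 1"] pos[of "j - 2"] j by (cases "j = 1") (auto simp: diff_diff_eq numeral_2_eq_2)
      show "M - j = 1 \<or> 0 < q (j + 1)"
        using pos[of "j + 1"] j by (cases "j = n") (auto simp: M_def)
    qed (use j pos[of j] pos[of "j - 1"] in \<open>auto simp: M_def\<close>)
    then show ?thesis
      using j by (simp add: q'_def of_nat_diff algebra_simps numeral_2_eq_2 diff_diff_eq)
  qed
  have a': "a j + 2 * (if j = 0 then 0 else a (j - 1)) = real (Suc n choose j) * (q' j / M)" for j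
  proof (cases j)
    case 0
    then show ?thesis using M by (simp add: a q'_def)
  next
    case (Suc i)
    have 1: "real (n choose i) * M = real (Suc n choose Suc i) * real (Suc i)"
      using Suc_times_binomial_eq[of n i] unfolding M_def by (metis mult.commute of_nat_mult)
    have 2: "real (n choose Suc i) * M = real (Suc n choose Suc i) * (M - real (Suc i))"
    proof -
      have "real (n choose Suc i) = real (Suc n choose Suc i) - real (n choose i)" by simp
      then show ?thesis using 1 by (simp add: algebra_simps)
    qed
    have "M * (a j + 2 * a i) = real (n choose Suc i) * M * q (Suc i) + 2 * (real (n choose i) * M) * q i"
      by (simp add: a Suc algebra_simps)
    also have "\<dots> = real (Suc n choose Suc i) * q' j"
      unfolding 1 2 by (simp add: q'_def Suc algebra_simps)
    finally show ?thesis using M by (simp add: field_simps Suc)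
  qed
  show ?thesis
    unfolding ultra_log_concave_def
  proof (intro exI[of _ "\<lambda>j. q' j / M"] conjI allI impI)
    show "0 < q' j / M" if "j \<le> Suc n" for j using pos'[OF that] M by simp
    show "q' (j - 1) / M * (q' (j + 1) / M) \<le> (q' j / M)\<^sup>2" if "1 \<le> j \<and> j < Suc n" for j
      using lc'[of j] that M by (simp add: divide_simps power2_eq_square)
  qed (rule a')
qed

lemma ultra_log_concave_main:
  assumes "ultra_log_concave 5 (\<lambda>j. real_of_int (coeff P j))"
  shows "ultra_log_concave (N + 5) (\<lambda>j. real_of_int (coeff (P * [:1, 2:] ^ N) j))"
proof (induction N)
  case 0
  then show ?case using assms by simp
next
  case (Suc N)
  have "P * [:1, 2:] ^ Suc N = P * [:1, 2:] ^ N + pCons 0 (smult 2 (P * [:1, 2:] ^ N))"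
    by (simp add: algebra_simps)
  then have "real_of_int (coeff (P * [:1, 2:] ^ Suc N) j) = real_of_int (coeff (P * [:1, 2:] ^ N) j)
     + 2 * (if j = 0 then 0 else real_of_int (coeff (P * [:1, 2:] ^ N) (j - 1)))" for j
    by (cases j) (simp_all add: coeff_pCons)
  then show ?case using ultra_log_concave_linear[OF Suc] by simp
qed

text \<open>The constants arise by clearing the binomials 1, 5, 10, 10, 5, 1.\<close>

lemma ultra_log_concave_5I:
  assumes "\<And>j. j \<le> 5 \<Longrightarrow> 0 < a j" "\<And>j. j > 5 \<Longrightarrow> a j = 0"
    and "5 * (a 0 * a 2) \<le> 2 * (a 1)\<^sup>2" "2 * (a 1 * a 3) \<le> (a 2)\<^sup>2" "2 * (a 2 * a 4) \<le> (a 3)\<^sup>2" "5 * (a 3 * a 5) \<le> 2 * (a 4)\<^sup>2"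
  shows "ultra_log_concave 5 a"
proof -
  define q where "q j = a j / real (5 choose j)" for j
  have "q (j - 1) * q (j + 1) \<le> (q j)\<^sup>2" if "1 \<le> j \<and> j < 5" for j
  proof -
    from that have "j = 1 \<or> j = 2 \<or> j = 3 \<or> j = 4" by auto
    then show ?thesis using assms(3-6)
      by (auto simp: q_def eval_nat_numeral power2_eq_square field_simps)
  qed
  moreover have "0 < q j" if "j \<le> 5" for j using that assms(1) by (simp add: q_def)
  moreover have "a j = real (5 choose j) * q j" for j
    using assms(2)[of j] by (cases "j \<le> 5") (simp_all add: q_def)
  ultimately show ?thesis unfolding ultra_log_concave_def by blast
qed

lemma ulc_F4: "ultra_log_concave 5 (\<lambda>j. real_of_int (coeff F4 j))"
proof (rule ultra_log_concave_5I)
  fix j :: nat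
  assume "j \<le> 5"
  then have "j = 0 \<or> j = 1 \<or> j = 2 \<or> j = 3 \<or> j = 4 \<or> j = 5" by auto
  then show "0 < real_of_int (coeff F4 j)" by (auto simp: F4_def eval_nat_numeral)
next
  fix j :: nat
  assume "j > 5"
  moreover have "degree F4 = 5" by (simp add: F4_def)
  ultimately show "real_of_int (coeff F4 j) = 0" by (simp add: coeff_eq_0)
qed (simp_all add: F4_def eval_nat_numeral)

lemma ulc_FU: "ultra_log_concave 5 (\<lambda>j. real_of_int (coeff FU j))"
proof (rule ultra_log_concave_5I)
  fix j :: nat
  assume "j \<le> 5"
  then have "j = 0 \<or> j = 1 \<or> j = 2 \<or> j = 3 \<or> j = 4 \<or> j = 5" by auto
  then show "0 < real_of_int (coeff FU j)" by (auto simp: FU_def eval_nat_numeral)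
next
  fix j :: nat
  assume "j > 5"
  moreover have "degree FU = 5" by (simp add: FU_def)
  ultimately show "real_of_int (coeff FU j) = 0" by (simp add: coeff_eq_0)
qed (simp_all add: FU_def eval_nat_numeral)

text \<open>For the binomials alone the quotient of outer product and middle square is
  \<open>j (n - j) / ((j + 1) (n - j + 1))\<close>; only the factor \<open>j / (j + 1)\<close> is
  kept.\<close>

lemma ultra_log_concaveD:
  assumes "ultra_log_concave n a"
  shows "j \<le> n \<Longrightarrow> 0 < a j"
    and "1 \<le> j \<Longrightarrow> j < n \<Longrightarrow> a (j - 1) * a (j + 1) * (real j + 1) \<le> (a j)\<^sup>2 * real j"
proof -
  obtain q where pos: "\<And>j. j \<le> n \<Longrightarrow> 0 < q j"
    and lc: "\<And>j. 1 \<le> j \<Longrightarrow> j < n \<Longrightarrow> q (j - 1) * q (j + 1) \<le> (q j)\<^sup>2"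
    and a: "\<And>j. a j = real (n choose j) * q j"
    using assms by (auto simp: ultra_log_concave_def)
  show pa: "0 < a j" if "j \<le> n" for j using pos[of j] that by (simp add: a)
  assume j: "1 \<le> j" "j < n"
  then obtain i where i: "j = Suc i" by (cases j) auto
  define s where "s = real n - real j"
  have s: "s > 0" using j by (simp add: s_def)
  have absorb: "real (n choose Suc m) * real (Suc m) = real (n choose m) * (real n - real m)" if "m \<le> n" for m
    using binomial_absorb_comp[of n m] binomial_absorption[of m n] that
    by (metis binomial_fact_lemma mult.commute of_nat_diff of_nat_mult Suc_times_binomial_add times_binomial_minus1_eq binomial_absorb_comp)
  have c1: "real (n choose j) * real j = real (n choose i) * (s + 1)"
    using absorb[of i] j i by (simp add: s_def)
  have c2: "real (n choose (j + 1)) * (real j + 1) = real (n choose j) * s"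
    using absorb[of j] j by (simp add: s_def algebra_simps)
  have "(a (j - 1) * a (j + 1) * (real j + 1)) * (s + 1) =
     (real (n choose i) * (s + 1)) * (real (n choose (j + 1)) * (real j + 1)) * (q (j - 1) * q (j + 1))"
    by (simp add: a i)
  also have "\<dots> = (real (n choose j))\<^sup>2 * real j * s * (q (j - 1) * q (j + 1))"
    unfolding c1[symmetric] c2 by (simp add: power2_eq_square)
  also have "\<dots> \<le> (real (n choose j))\<^sup>2 * real j * s * (q j)\<^sup>2"
    using s lc[OF j] by (intro mult_left_mono) auto
  also have "\<dots> = (a j)\<^sup>2 * real j * s" by (simp add: a power2_eq_square)
  also have "\<dots> \<le> (a j)\<^sup>2 * real j * (s + 1)" by (intro mult_left_mono) auto
  finally show "a (j - 1) * a (j + 1) * (real j + 1) \<le> (a j)\<^sup>2 * real j"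
    using s by (simp add: mult_le_cancel_right)
qed

section \<open>Perturbing an ultra-log-concave sequence\<close>

lemma linear_times_geometric: "1 \<le> j \<Longrightarrow> real j * (5 / 6) ^ (j - 1) \<le> 5 / 2"
proof (induction j rule: dec_induct)
  case (step j)
  obtain i where i: "j = Suc i" using step by (cases j) auto
  show ?case
  \<comment> \<open>From 5 on the sequence no longer grows, as \<open>5/6 (j + 1) <= j\<close>; its
    maximum is \<open>3125/1296 < 5/2\<close>.\<close>
  proof (cases "j \<ge> 5")
    case True
    have "real (Suc j) * (5 / 6) ^ (Suc j - 1) = (5 / 6 * (real j + 1)) * (5 / 6) ^ (j - 1)"
      by (simp add: i)
    also have "\<dots> \<le> real j * (5 / 6) ^ (j - 1)"
      using True by (intro mult_right_mono) auto
    finally show ?thesis using step by simp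
  next
    case False
    then have "j = 1 \<or> j = 2 \<or> j = 3 \<or> j = 4" using step by auto
    then show ?thesis by (auto simp: eval_nat_numeral)
  qed
qed simp

text \<open>The two factors bound the relative enlargement of the neighbours of index
  \<open>j\<close>. With \<open>y\<close> for the lower one, \<open>j y <= 5/12\<close>, and
  \<open>5/12 (61/36 + 25/216) < 1\<close>, so the margin \<open>1 + 1/j\<close> absorbs
  both.\<close>

lemma perturbation_factor:
  assumes "1 \<le> j"
  shows "(1 + (5 / 6) ^ (j - 1) / 6) * (1 + (5 / 6) ^ (j + 1) / 6) * real j \<le> real j + 1"
proof -
  define y :: real where "y = (5 / 6) ^ (j - 1) / 6"
  have y2: "(5 / 6) ^ (j + 1) / 6 = 25 / 36 * y"
    using assms by (cases j) (simp_all add: y_def)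
  have y: "0 \<le> y" "y \<le> 1 / 6" by (simp_all add: y_def power_le_one)
  have jy: "real j * y \<le> 5 / 12" using linear_times_geometric[OF assms] by (simp add: y_def)
  have "(1 + y) * (1 + 25 / 36 * y) * real j = real j + (real j * y) * (61 / 36 + 25 / 36 * y)"
    by (simp add: field_simps)
  also have "\<dots> \<le> real j + 5 / 12 * (61 / 36 + 25 / 36 * (1 / 6))"
    using jy y assms by (intro add_left_mono mult_mono) auto
  also have "\<dots> \<le> real j + 1" by simp
  finally show ?thesis unfolding y2 y_def[symmetric] .
qed

text \<open>Only the neighbours are charged with their perturbation; the one in the middle helps and
  is dropped.\<close>

lemma log_concave_perturbed:
  assumes ulc: "ultra_log_concave n a"
    and w: "\<And>j. 0 \<le> w j" "\<And>j. j \<le> n \<Longrightarrow> 6 ^ Suc j * w j \<le> 5 ^ j * a j"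
    and j: "1 \<le> j" "j < n"
  shows "(a (j - 1) + w (j - 1)) * (a (j + 1) + w (j + 1)) \<le> (a j + w j)\<^sup>2"
proof -
  have bd: "0 \<le> a i + w i \<and> a i + w i \<le> a i * (1 + (5 / 6) ^ i / 6)" if "i \<le> n" for i
    using w(1)[of i] w(2)[OF that] ultra_log_concaveD(1)[OF ulc that]
    by (simp add: field_simps power_divide)
  let ?e = "\<lambda>i. 1 + (5 / 6) ^ i / (6::real)"
  have a: "0 < a (j - 1)" "0 < a (j + 1)" "0 < a j"
    using ultra_log_concaveD(1)[OF ulc] j by auto
  have "(a (j - 1) + w (j - 1)) * (a (j + 1) + w (j + 1)) \<le> (a (j - 1) * ?e (j - 1)) * (a (j + 1) * ?e (j + 1))"
    using bd[of "j - 1"] bd[of "j + 1"] j a by (intro mult_mono) (auto intro!: mult_nonneg_nonneg add_nonneg_nonneg)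
  also have "\<dots> = (a (j - 1) * a (j + 1)) * (?e (j - 1) * ?e (j + 1))" by simp
  finally have 1: "(a (j - 1) + w (j - 1)) * (a (j + 1) + w (j + 1)) \<le> (a (j - 1) * a (j + 1)) * (?e (j - 1) * ?e (j + 1))" .
  have "(a (j - 1) * a (j + 1)) * (?e (j - 1) * ?e (j + 1)) * real j
      = (a (j - 1) * a (j + 1)) * (?e (j - 1) * ?e (j + 1) * real j)" by simp
  also have "\<dots> \<le> (a (j - 1) * a (j + 1)) * (real j + 1)"
    using a j by (intro mult_left_mono perturbation_factor) auto
  also have "\<dots> \<le> (a j)\<^sup>2 * real j" by (rule ultra_log_concaveD(2)[OF ulc j])
  finally have "(a (j - 1) * a (j + 1)) * (?e (j - 1) * ?e (j + 1)) \<le> (a j)\<^sup>2"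
    using j by (simp add: mult_le_cancel_right)
  also have "\<dots> \<le> (a j + w j)\<^sup>2" using a w(1)[of j] by (intro power_mono) auto
  finally show ?thesis using 1 by linarith
qed

subsection \<open>The mode of the main term\<close>

text \<open>Up to a common positive factor, \<open>binomial_window (real J) (real N - real J) i\<close> is the
  coefficient of \<open>x ^ (J - i)\<close> in \<open>(1 + 2 * x) ^ N\<close>, for \<open>i \<le> 6\<close>.\<close>

definition binomial_window :: "real \<Rightarrow> real \<Rightarrow> nat \<Rightarrow> real" where
  "binomial_window x y i = (\<Prod>t<i. x - real t) * (\<Prod>t\<in>{i..<6}. 2 * (y + real t + 1))"

text \<open>Mirrors the recurrence \<open>l c_l = 2 (N - l + 1) c_(l-1)\<close> of the coefficients
  \<open>c_l\<close> of \<open>(1 + 2 x)^N\<close> at \<open>l = J - i\<close>.\<close>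

lemma binomial_window_Suc:
  "i < 6 \<Longrightarrow> binomial_window x y i * (x - real i) = 2 * (y + real i + 1) * binomial_window x y (Suc i)"
  unfolding binomial_window_def by (simp add: prod.atLeast_Suc_lessThan algebra_simps)

lemma coeff_linear_power_window:
  assumes "6 \<le> J" "J \<le> N"
  obtains D :: real where "D > 0"
    "\<And>i. i \<le> 6 \<Longrightarrow> real_of_int (coeff ([:1, 2:] ^ N) (J - i)) = D * binomial_window (real J) (real N - real J) i"
proof -
  let ?w = "binomial_window (real J) (real N - real J)" and ?V = "\<lambda>j. real_of_int (coeff ([:1, 2:] ^ N) j)"
  have V: "?V j = real (N choose j) * 2 ^ j" if "j \<le> N" for j
    using that by (simp add: coeff_linear_poly_power)
  have w0: "?w 0 > 0" unfolding binomial_window_def using assms by (auto intro!: mult_pos_pos prod_pos)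
  define D where "D = ?V J / ?w 0"
  have "D > 0" using w0 assms by (simp add: D_def V)
  moreover have "?V (J - i) = D * ?w i" if "i \<le> 6" for i
    using that
  proof (induction i)
    case 0
    then show ?case using w0 by (simp add: D_def)
  next
    case (Suc i)
    obtain l where l: "J - i = Suc l" using Suc.prems assms by (cases "J - i") auto
    have lJ: "J - Suc i = l" "real J - real i = real (Suc l)" using l by auto
    have IH: "?V (Suc l) = D * ?w i" using Suc l by simp
    have "real (N choose Suc l) * real (Suc l) = real (N choose l) * (real N - real l)"
    proof -
      have "Suc l * (N choose Suc l) = (N - l) * (N choose l)"
        using binomial_absorb_comp[of N l] binomial_absorption[of l N] by simp
      then have "real (Suc l * (N choose Suc l)) = real ((N - l) * (N choose l))" by (rule arg_cong)
      then show ?thesis using l assms by (simp add: of_nat_diff algebra_simps)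
    qed
    note absorb = this
    have "?V (Suc l) * real (Suc l) = 2 * 2 ^ l * (real (N choose Suc l) * real (Suc l))"
      using l assms by (simp add: V del: of_nat_Suc)
    also note absorb
    also have "2 * 2 ^ l * (real (N choose l) * (real N - real l)) = 2 * (real N - real l) * ?V l"
      using l assms by (simp add: V)
    finally have "2 * (real N - real l) * ?V l = D * (?w i * (real J - real i))"
      unfolding IH lJ(2) by (simp add: mult.assoc del: of_nat_Suc)
    also have "\<dots> = D * (2 * (real N - real J + real i + 1) * ?w (Suc i))"
      using binomial_window_Suc[of i "real J" "real N - real J"] Suc.prems by simp
    also have "real N - real J + real i + 1 = real N - real l" using lJ(2) by simp
    finally have "(2 * (real N - real l)) * ?V l = (2 * (real N - real l)) * (D * ?w (Suc i))"
      by (simp add: mult.assoc mult.left_commute)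
    moreover have "real N - real l > 0" using l assms by simp
    ultimately show ?case unfolding lJ(1) by simp
  qed
  ultimately show ?thesis by (rule that)
qed

text \<open>Up to the common factor, this is the coefficient of index \<open>J - s\<close> in
  \<open>P (1 + 2 x)^N\<close>. A quintic \<open>P\<close> with shift 1 reaches back to
  \<open>J - 6\<close>, hence the six factors in a window.\<close>

definition window_sum :: "(nat \<Rightarrow> real) \<Rightarrow> real \<Rightarrow> real \<Rightarrow> nat \<Rightarrow> real" where
  "window_sum f x y s = (\<Sum>i<6. f i * binomial_window x y (i + s))"

lemma coeff_quintic_mult:
  fixes P Q :: "int poly"
  assumes "degree P \<le> 5" "5 \<le> j"
  shows "coeff (P * Q) j = (\<Sum>i<6. coeff P i * coeff Q (j - i))"
proof -
  have "coeff (P * Q) j = (\<Sum>i\<le>j. coeff P i * coeff Q (j - i))" by (rule coeff_mult)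
  also have "\<dots> = (\<Sum>i<6. coeff P i * coeff Q (j - i))"
    using assms by (intro sum.mono_neutral_right) (auto simp: coeff_eq_0)
  finally show ?thesis .
qed

lemma coeff_main_window:
  assumes "degree P \<le> 5" "6 \<le> J" "J \<le> N"
  obtains D :: real where "D > 0"
    "real_of_int (coeff (P * [:1, 2:] ^ N) J) = D * window_sum (\<lambda>i. coeff P i) (real J) (real N - real J) 0"
    "real_of_int (coeff (P * [:1, 2:] ^ N) (J - 1)) = D * window_sum (\<lambda>i. coeff P i) (real J) (real N - real J) 1"
proof -
  obtain D :: real where D: "D > 0"
    "\<And>i. i \<le> 6 \<Longrightarrow> real_of_int (coeff ([:1, 2:] ^ N) (J - i)) = D * binomial_window (real J) (real N - real J) i"
    using coeff_linear_power_window[OF assms(2,3)] by blast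
  have "real_of_int (coeff (P * [:1, 2:] ^ N) J) = D * window_sum (\<lambda>i. coeff P i) (real J) (real N - real J) 0"
    using assms by (simp add: coeff_quintic_mult D(2) window_sum_def sum_distrib_left mult.left_commute del: mult_pCons_left)
  moreover have "real_of_int (coeff (P * [:1, 2:] ^ N) (J - 1)) = D * window_sum (\<lambda>i. coeff P i) (real J) (real N - real J) 1"
  proof -
    have "coeff (P * [:1, 2:] ^ N) (J - 1) = (\<Sum>i<6. coeff P i * coeff ([:1, 2:] ^ N) (J - Suc i))"
      using assms by (subst coeff_quintic_mult) auto
    then show ?thesis
      by (simp add: D(2) window_sum_def sum_distrib_left mult.left_commute)
  qed
  ultimately show ?thesis using D(1) that by blast
qed

lemma window_sum_eval:
  "window_sum f x y 0 = f 0 * (64 * ((y+1) * (y+2) * (y+3) * (y+4) * (y+5) * (y+6)))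
    + f 1 * (32 * (x * (y+2) * (y+3) * (y+4) * (y+5) * (y+6)))
    + f 2 * (16 * (x * (x-1) * (y+3) * (y+4) * (y+5) * (y+6)))
    + f 3 * (8 * (x * (x-1) * (x-2) * (y+4) * (y+5) * (y+6)))
    + f 4 * (4 * (x * (x-1) * (x-2) * (x-3) * (y+5) * (y+6)))
    + f 5 * (2 * (x * (x-1) * (x-2) * (x-3) * (x-4) * (y+6)))"
  "window_sum f x y 1 = f 0 * (32 * (x * (y+2) * (y+3) * (y+4) * (y+5) * (y+6)))
    + f 1 * (16 * (x * (x-1) * (y+3) * (y+4) * (y+5) * (y+6)))
    + f 2 * (8 * (x * (x-1) * (x-2) * (y+4) * (y+5) * (y+6)))
    + f 3 * (4 * (x * (x-1) * (x-2) * (x-3) * (y+5) * (y+6)))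
    + f 4 * (2 * (x * (x-1) * (x-2) * (x-3) * (x-4) * (y+6)))
    + f 5 * (x * (x-1) * (x-2) * (x-3) * (x-4) * (x-5))"
  by (simp_all add: window_sum_def binomial_window_def eval_nat_numeral prod.atLeast_Suc_lessThan algebra_simps)

lemma coeffs_F4: "coeff F4 0 = 1" "coeff F4 1 = 9" "coeff F4 2 = 28" "coeff F4 3 = 38" "coeff F4 4 = 20" "coeff F4 5 = 1"
  by (simp_all add: F4_def eval_nat_numeral)

lemma coeffs_FU: "coeff FU 0 = 1" "coeff FU 1 = 10" "coeff FU 2 = 36" "coeff FU 3 = 62" "coeff FU 4 = 52" "coeff FU 5 = 17"
  by (simp_all add: FU_def eval_nat_numeral)

text \<open>The mode depends on \<open>N mod 3\<close>, whence the families \<open>N = 47 + 3 * t\<close>, \<open>48 + 3 * t\<close>, \<open>49 + 3 * t\<close>. Each difference is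
  a polynomial in \<open>t\<close> with positive coefficients. The ratio \<open>(10 * N + 1) / (10 * N)\<close> leaves room for the rest.\<close>

lemma window_F4_47_left:
  fixes t :: real
  assumes "t \<ge> 0"
  shows "(10 * (47 + 3 * t) + 1) * window_sum (\<lambda>i. coeff F4 i) (34 + 2 * t) (13 + t) 1 \<le> 10 * (47 + 3 * t) * window_sum (\<lambda>i. coeff F4 i) (34 + 2 * t) (13 + t) 0"
proof -
  have "10 * (47 + 3 * t) * window_sum (\<lambda>i. coeff F4 i) (34 + 2 * t) (13 + t) 0 - (10 * (47 + 3 * t) + 1) * window_sum (\<lambda>i. coeff F4 i) (34 + 2 * t) (13 + t) 1
      = 4242739978368 + t * (1526648796168 + t * (228738255968 + t * (18266179320 + t * (819938912 + t * (19615872 + t * (195392))))))"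
    unfolding window_sum_eval coeffs_F4 of_int_1 of_int_numeral by algebra
  also have "\<dots> \<ge> 0" using assms by simp
  finally show ?thesis by simp
qed

lemma window_F4_47_right:
  fixes t :: real
  assumes "t \<ge> 0"
  shows "(10 * (47 + 3 * t) + 1) * window_sum (\<lambda>i. coeff F4 i) (35 + 2 * t) (12 + t) 0 \<le> 10 * (47 + 3 * t) * window_sum (\<lambda>i. coeff F4 i) (35 + 2 * t) (12 + t) 1"
proof -
  have "10 * (47 + 3 * t) * window_sum (\<lambda>i. coeff F4 i) (35 + 2 * t) (12 + t) 1 - (10 * (47 + 3 * t) + 1) * window_sum (\<lambda>i. coeff F4 i) (35 + 2 * t) (12 + t) 0
      = 1496537602560 + t * (541572875808 + t * (81624297032 + t * (6558178584 + t * (296257904 + t * (7134336 + t * (71552))))))"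
    unfolding window_sum_eval coeffs_F4 of_int_1 of_int_numeral by algebra
  also have "\<dots> \<ge> 0" using assms by simp
  finally show ?thesis by simp
qed

lemma window_F4_48_left:
  fixes t :: real
  assumes "t \<ge> 0"
  shows "(10 * (48 + 3 * t) + 1) * window_sum (\<lambda>i. coeff F4 i) (35 + 2 * t) (13 + t) 1 \<le> 10 * (48 + 3 * t) * window_sum (\<lambda>i. coeff F4 i) (35 + 2 * t) (13 + t) 0"
proof -
  have "10 * (48 + 3 * t) * window_sum (\<lambda>i. coeff F4 i) (35 + 2 * t) (13 + t) 0 - (10 * (48 + 3 * t) + 1) * window_sum (\<lambda>i. coeff F4 i) (35 + 2 * t) (13 + t) 1
      = 2442612506880 + t * (864777621256 + t * (127501777232 + t * (10020646936 + t * (442753904 + t * (10427680 + t * (102272))))))"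
    unfolding window_sum_eval coeffs_F4 of_int_1 of_int_numeral by algebra
  also have "\<dots> \<ge> 0" using assms by simp
  finally show ?thesis by simp
qed

lemma window_F4_48_right:
  fixes t :: real
  assumes "t \<ge> 0"
  shows "(10 * (48 + 3 * t) + 1) * window_sum (\<lambda>i. coeff F4 i) (36 + 2 * t) (12 + t) 0 \<le> 10 * (48 + 3 * t) * window_sum (\<lambda>i. coeff F4 i) (36 + 2 * t) (12 + t) 1"
proof -
  have "10 * (48 + 3 * t) * window_sum (\<lambda>i. coeff F4 i) (36 + 2 * t) (12 + t) 1 - (10 * (48 + 3 * t) + 1) * window_sum (\<lambda>i. coeff F4 i) (36 + 2 * t) (12 + t) 0
      = 3807996192000 + t * (1354716206400 + t * (200747918496 + t * (15860396448 + t * (704628928 + t * (16690368 + t * (164672))))))"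
    unfolding window_sum_eval coeffs_F4 of_int_1 of_int_numeral by algebra
  also have "\<dots> \<ge> 0" using assms by simp
  finally show ?thesis by simp
qed

lemma window_F4_49_left:
  fixes t :: real
  assumes "t \<ge> 0"
  shows "(10 * (49 + 3 * t) + 1) * window_sum (\<lambda>i. coeff F4 i) (36 + 2 * t) (13 + t) 1 \<le> 10 * (49 + 3 * t) * window_sum (\<lambda>i. coeff F4 i) (36 + 2 * t) (13 + t) 0"
proof -
  have "10 * (49 + 3 * t) * window_sum (\<lambda>i. coeff F4 i) (36 + 2 * t) (13 + t) 0 - (10 * (49 + 3 * t) + 1) * window_sum (\<lambda>i. coeff F4 i) (36 + 2 * t) (13 + t) 1
      = 204084178560 + t * (73215480528 + t * (10929647512 + t * (869076296 + t * (38824704 + t * (923968 + t * (9152))))))"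
    unfolding window_sum_eval coeffs_F4 of_int_1 of_int_numeral by algebra
  also have "\<dots> \<ge> 0" using assms by simp
  finally show ?thesis by simp
qed

lemma window_F4_49_right:
  fixes t :: real
  assumes "t \<ge> 0"
  shows "(10 * (49 + 3 * t) + 1) * window_sum (\<lambda>i. coeff F4 i) (37 + 2 * t) (12 + t) 0 \<le> 10 * (49 + 3 * t) * window_sum (\<lambda>i. coeff F4 i) (37 + 2 * t) (12 + t) 1"
proof -
  have "10 * (49 + 3 * t) * window_sum (\<lambda>i. coeff F4 i) (37 + 2 * t) (12 + t) 1 - (10 * (49 + 3 * t) + 1) * window_sum (\<lambda>i. coeff F4 i) (37 + 2 * t) (12 + t) 0
      = 6587743448160 + t * (2304468463008 + t * (335806746216 + t * (26091708728 + t * (1140076048 + t * (26561920 + t * (257792))))))"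
    unfolding window_sum_eval coeffs_F4 of_int_1 of_int_numeral by algebra
  also have "\<dots> \<ge> 0" using assms by simp
  finally show ?thesis by simp
qed

lemma window_FU_47_left:
  fixes t :: real
  assumes "t \<ge> 0"
  shows "(10 * (47 + 3 * t) + 1) * window_sum (\<lambda>i. coeff FU i) (35 + 2 * t) (12 + t) 1 \<le> 10 * (47 + 3 * t) * window_sum (\<lambda>i. coeff FU i) (35 + 2 * t) (12 + t) 0"
proof -
  have "10 * (47 + 3 * t) * window_sum (\<lambda>i. coeff FU i) (35 + 2 * t) (12 + t) 0 - (10 * (47 + 3 * t) + 1) * window_sum (\<lambda>i. coeff FU i) (35 + 2 * t) (12 + t) 1
      = 1260949818240 + t * (463528074168 + t * (70974229232 + t * (5794066440 + t * (265980560 + t * (6509952 + t * (66368))))))"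
    unfolding window_sum_eval coeffs_FU of_int_1 of_int_numeral by algebra
  also have "\<dots> \<ge> 0" using assms by simp
  finally show ?thesis by simp
qed

lemma window_FU_47_right:
  fixes t :: real
  assumes "t \<ge> 0"
  shows "(10 * (47 + 3 * t) + 1) * window_sum (\<lambda>i. coeff FU i) (36 + 2 * t) (11 + t) 0 \<le> 10 * (47 + 3 * t) * window_sum (\<lambda>i. coeff FU i) (36 + 2 * t) (11 + t) 1"
proof -
  have "10 * (47 + 3 * t) * window_sum (\<lambda>i. coeff FU i) (36 + 2 * t) (11 + t) 1 - (10 * (47 + 3 * t) + 1) * window_sum (\<lambda>i. coeff FU i) (36 + 2 * t) (11 + t) 0
      = 8447740922880 + t * (3079658715840 + t * (467680387808 + t * (37869555456 + t * (1724445536 + t * (41870016 + t * (423488))))))"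
    unfolding window_sum_eval coeffs_FU of_int_1 of_int_numeral by algebra
  also have "\<dots> \<ge> 0" using assms by simp
  finally show ?thesis by simp
qed

lemma window_FU_48_left:
  fixes t :: real
  assumes "t \<ge> 0"
  shows "(10 * (48 + 3 * t) + 1) * window_sum (\<lambda>i. coeff FU i) (35 + 2 * t) (13 + t) 1 \<le> 10 * (48 + 3 * t) * window_sum (\<lambda>i. coeff FU i) (35 + 2 * t) (13 + t) 0"
proof -
  have "10 * (48 + 3 * t) * window_sum (\<lambda>i. coeff FU i) (35 + 2 * t) (13 + t) 0 - (10 * (48 + 3 * t) + 1) * window_sum (\<lambda>i. coeff FU i) (35 + 2 * t) (13 + t) 1
      = 9304906490880 + t * (3317700913096 + t * (492758438000 + t * (39022256632 + t * (1737784208 + t * (41262976 + t * (408128))))))"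
    unfolding window_sum_eval coeffs_FU of_int_1 of_int_numeral by algebra
  also have "\<dots> \<ge> 0" using assms by simp
  finally show ?thesis by simp
qed

lemma window_FU_48_right:
  fixes t :: real
  assumes "t \<ge> 0"
  shows "(10 * (48 + 3 * t) + 1) * window_sum (\<lambda>i. coeff FU i) (36 + 2 * t) (12 + t) 0 \<le> 10 * (48 + 3 * t) * window_sum (\<lambda>i. coeff FU i) (36 + 2 * t) (12 + t) 1"
proof -
  have "10 * (48 + 3 * t) * window_sum (\<lambda>i. coeff FU i) (36 + 2 * t) (12 + t) 1 - (10 * (48 + 3 * t) + 1) * window_sum (\<lambda>i. coeff FU i) (36 + 2 * t) (12 + t) 0
      = 1876864953600 + t * (668563288896 + t * (99192825504 + t * (7846139424 + t * (348974272 + t * (8275008 + t * (81728))))))"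
    unfolding window_sum_eval coeffs_FU of_int_1 of_int_numeral by algebra
  also have "\<dots> \<ge> 0" using assms by simp
  finally show ?thesis by simp
qed

lemma window_FU_49_left:
  fixes t :: real
  assumes "t \<ge> 0"
  shows "(10 * (49 + 3 * t) + 1) * window_sum (\<lambda>i. coeff FU i) (36 + 2 * t) (13 + t) 1 \<le> 10 * (49 + 3 * t) * window_sum (\<lambda>i. coeff FU i) (36 + 2 * t) (13 + t) 0"
proof -
  have "10 * (49 + 3 * t) * window_sum (\<lambda>i. coeff FU i) (36 + 2 * t) (13 + t) 0 - (10 * (49 + 3 * t) + 1) * window_sum (\<lambda>i. coeff FU i) (36 + 2 * t) (13 + t) 1
      = 6012982546560 + t * (2106325309008 + t * (307357123096 + t * (23914075496 + t * (1046358144 + t * (24411808 + t * (237248))))))"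
    unfolding window_sum_eval coeffs_FU of_int_1 of_int_numeral by algebra
  also have "\<dots> \<ge> 0" using assms by simp
  finally show ?thesis by simp
qed

lemma window_FU_49_right:
  fixes t :: real
  assumes "t \<ge> 0"
  shows "(10 * (49 + 3 * t) + 1) * window_sum (\<lambda>i. coeff FU i) (37 + 2 * t) (12 + t) 0 \<le> 10 * (49 + 3 * t) * window_sum (\<lambda>i. coeff FU i) (37 + 2 * t) (12 + t) 1"
proof -
  have "10 * (49 + 3 * t) * window_sum (\<lambda>i. coeff FU i) (37 + 2 * t) (12 + t) 1 - (10 * (49 + 3 * t) + 1) * window_sum (\<lambda>i. coeff FU i) (37 + 2 * t) (12 + t) 0
      = 6437966974560 + t * (2253135688992 + t * (328477999080 + t * (25533806168 + t * (1116192208 + t * (26016736 + t * (252608))))))"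
    unfolding window_sum_eval coeffs_FU of_int_1 of_int_numeral by algebra
  also have "\<dots> \<ge> 0" using assms by simp
  finally show ?thesis by simp
qed

subsection \<open>Computation for small parameters\<close>

definition H_mode :: "nat \<Rightarrow> nat \<Rightarrow> nat" where "H_mode k r = (4 * k + 2 * r + 8) div 3"
definition U_mode :: "nat \<Rightarrow> nat \<Rightarrow> nat" where "U_mode k r = (4 * k + 2 * r + 9) div 3"

definition H_coeff :: "nat \<Rightarrow> nat \<Rightarrow> nat \<Rightarrow> int" where
  "H_coeff k r = coeff (F4 * [:1, 2:] ^ (2 * k + r - 1) + rest_poly k r)"

definition U_coeff :: "nat \<Rightarrow> nat \<Rightarrow> nat \<Rightarrow> int" where
  "U_coeff k r = coeff (FU * [:1, 2:] ^ (2 * k + r - 1) + rest_poly k r)"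

definition peak_at :: "(nat \<Rightarrow> int) \<Rightarrow> nat \<Rightarrow> bool" where
  "peak_at a m \<longleftrightarrow> a (m - 1) \<le> a m \<and> a (m + 1) \<le> a m"

text \<open>All that has to be known of the two coefficient sequences besides positivity, in a form
  that is computed for small \<open>k\<close> and derived for large \<open>k\<close>. The
  independence number is \<open>2 k + r + 6\<close>.\<close>

definition shape_ok :: "nat \<Rightarrow> nat \<Rightarrow> bool" where
  "shape_ok k r \<longleftrightarrow>
     (\<forall>j. 1 \<le> j \<and> j \<le> 2 * k + r + 5 \<longrightarrow> H_coeff k r (j - 1) * H_coeff k r (j + 1) \<le> (H_coeff k r j)\<^sup>2) \<and>
     (\<forall>j. 1 \<le> j \<and> j \<le> 2 * k + r + 4 \<longrightarrow> U_coeff k r (j - 1) * U_coeff k r (j + 1) \<le> (U_coeff k r j)\<^sup>2) \<and>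
     \<not> U_coeff k r (2 * k + r + 4) * U_coeff k r (2 * k + r + 6) \<le> (U_coeff k r (2 * k + r + 5))\<^sup>2 \<and>
     peak_at (H_coeff k r) (H_mode k r) \<and> peak_at (U_coeff k r) (U_mode k r)"

section \<open>List arithmetic\<close>

fun add_list :: "int list \<Rightarrow> int list \<Rightarrow> int list" where
  "add_list [] ys = ys"
| "add_list (x # xs) [] = x # xs"
| "add_list (x # xs) (y # ys) = (x + y) # add_list xs ys"

definition mul_list :: "int \<Rightarrow> int list \<Rightarrow> int list" where
  "mul_list c xs = add_list xs (0 # map ((*) c) xs)"

fun log_concave_list :: "int list \<Rightarrow> bool" where
  "log_concave_list (a # b # c # xs) \<longleftrightarrow> a * c \<le> b * b \<and> log_concave_list (b # c # xs)"
| "log_concave_list xs \<longleftrightarrow> True"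

fun dominated_list :: "int \<Rightarrow> int \<Rightarrow> int list \<Rightarrow> int list \<Rightarrow> bool" where
  "dominated_list s t (w # ws) (p # ps) \<longleftrightarrow> s * w \<le> t * p \<and> dominated_list (6 * s) (5 * t) ws ps"
| "dominated_list s t ws ps \<longleftrightarrow> True"

fun peak_list :: "int list \<Rightarrow> bool" where
  "peak_list (a # b # c # xs) \<longleftrightarrow> a \<le> b \<and> c \<le> b"
| "peak_list xs \<longleftrightarrow> False"

definition shape_ok_lists :: "nat \<Rightarrow> nat \<Rightarrow> int list \<Rightarrow> int list \<Rightarrow> bool" where
  "shape_ok_lists k r hs us \<longleftrightarrow> length hs = 2 * k + r + 7 \<and> length us = 2 * k + r + 7 \<and>
     log_concave_list hs \<and> log_concave_list (butlast us) \<and> \<not> log_concave_list (drop (2 * k + r + 4) us) \<and>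
     peak_list (drop (H_mode k r - 1) hs) \<and> peak_list (drop (U_mode k r - 1) us)"

text \<open>The lists hold the coefficients of the four families of products that make up the polynomials; passing from \<open>k\<close>
  to \<open>k + 1\<close> multiplies each of them by two linear factors.\<close>

fun check :: "nat \<Rightarrow> nat \<Rightarrow> nat \<Rightarrow> int list \<Rightarrow> int list \<Rightarrow> int list \<Rightarrow> int list \<Rightarrow> bool" where
  "check 0 k r hs us ws cs \<longleftrightarrow> length hs = 2 * k + r + 5 \<and> dominated_list 6 1 (add_list ws cs) hs"
| "check (Suc l) k r hs us ws cs \<longleftrightarrow>
     (k = 3 \<and> r = 2 \<or> shape_ok_lists k r (add_list hs (add_list ws cs)) (add_list us (add_list ws cs))) \<and>
     check l (Suc k) r (mul_list 2 (mul_list 2 hs)) (mul_list 2 (mul_list 2 us))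
       (mul_list 1 (mul_list 2 ws)) (mul_list 1 (mul_list 1 cs))"

lemma Poly_add_list: "Poly (add_list xs ys) = Poly xs + Poly ys"
  by (induction xs ys rule: add_list.induct) simp_all

lemma Poly_map_mult: "Poly (map ((*) c) xs) = smult c (Poly xs)" for c :: int
  by (induction xs) simp_all

lemma Poly_mul_list: "Poly (mul_list c xs) = [:1, c:] * Poly xs"
  by (simp add: mul_list_def Poly_add_list Poly_map_mult)

lemma log_concave_list_nth:
  "log_concave_list xs \<Longrightarrow> 1 \<le> j \<Longrightarrow> j + 1 < length xs \<Longrightarrow> xs ! (j - 1) * xs ! (j + 1) \<le> (xs ! j)\<^sup>2"
proof (induction xs arbitrary: j rule: log_concave_list.induct)
  case (1 a b c xs)
  show ?case
  proof (cases "j = 1")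
    case True
    then show ?thesis using 1 by (simp add: power2_eq_square)
  next
    case False
    then have "j = Suc (Suc (j - 2))" using 1(3) by simp
    then obtain i where i: "j = Suc (Suc i)" ..
    then show ?thesis using 1(1)[of "Suc i"] 1(2,4) by simp
  qed
qed auto

lemma drop_eq_nth3:
  assumes "i + 2 < length xs"
  shows "drop i xs = xs ! i # xs ! (i + 1) # xs ! (i + 2) # drop (i + 3) xs"
  using Cons_nth_drop_Suc[of i xs] Cons_nth_drop_Suc[of "i + 1" xs] Cons_nth_drop_Suc[of "i + 2" xs] assms
  by (simp add: eval_nat_numeral)

lemma not_log_concave_list_drop:
  assumes "\<not> log_concave_list (drop i xs)" "length xs = i + 3"
  shows "\<not> xs ! i * xs ! (i + 2) \<le> (xs ! (i + 1))\<^sup>2"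
  using assms drop_eq_nth3[of i xs] by (simp add: power2_eq_square)

lemma peak_list_drop:
  assumes "peak_list (drop i xs)"
  shows "xs ! i \<le> xs ! (i + 1)" "xs ! (i + 2) \<le> xs ! (i + 1)" "i + 2 < length xs"
proof -
  obtain a b c ys where d: "drop i xs = a # b # c # ys"
    using assms by (cases "drop i xs" rule: peak_list.cases) auto
  have l: "i + 2 < length xs"
    using arg_cong[OF d, of length] by simp
  then show "xs ! i \<le> xs ! (i + 1)" "xs ! (i + 2) \<le> xs ! (i + 1)" "i + 2 < length xs"
    using assms unfolding drop_eq_nth3[OF l] by auto
qed

lemma coeff_Poly_nth: "i < length xs \<Longrightarrow> coeff (Poly xs) i = xs ! i" for xs :: "int list"
  by (simp add: coeff_Poly_eq nth_default_def)

lemma shape_ok_listsD: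
  assumes "shape_ok_lists k r hs us" and "H_coeff k r = coeff (Poly hs)" and "U_coeff k r = coeff (Poly us)"
  shows "shape_ok k r"
proof -
  have len: "length hs = 2 * k + r + 7" "length us = 2 * k + r + 7"
    using assms(1) by (auto simp: shape_ok_lists_def)
  have h: "H_coeff k r i = hs ! i" if "i < 2 * k + r + 7" for i
    using that len coeff_Poly_nth assms(2) by simp
  have u: "U_coeff k r i = us ! i" if "i < 2 * k + r + 7" for i
    using that len coeff_Poly_nth assms(3) by simp
  have m: "H_mode k r \<ge> 1" "U_mode k r \<ge> 1" by (simp_all add: H_mode_def U_mode_def)
  have "H_coeff k r (j - 1) * H_coeff k r (j + 1) \<le> (H_coeff k r j)\<^sup>2" if "1 \<le> j" "j \<le> 2 * k + r + 5" for j
    using log_concave_list_nth[of hs j] assms(1) len that by (simp add: h shape_ok_lists_def)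
  moreover have "U_coeff k r (j - 1) * U_coeff k r (j + 1) \<le> (U_coeff k r j)\<^sup>2" if "1 \<le> j" "j \<le> 2 * k + r + 4" for j
    using log_concave_list_nth[of "butlast us" j] assms(1) len that by (simp add: u shape_ok_lists_def nth_butlast)
  moreover have "\<not> U_coeff k r (2 * k + r + 4) * U_coeff k r (2 * k + r + 6) \<le> (U_coeff k r (2 * k + r + 5))\<^sup>2"
    using not_log_concave_list_drop[of "2 * k + r + 4" us] assms(1) len by (simp add: u shape_ok_lists_def eval_nat_numeral)
  moreover have "peak_at (H_coeff k r) (H_mode k r)"
    using peak_list_drop[of "H_mode k r - 1" hs] assms(1) len m by (simp add: h shape_ok_lists_def peak_at_def)
  moreover have "peak_at (U_coeff k r) (U_mode k r)"
    using peak_list_drop[of "U_mode k r - 1" us] assms(1) len m by (simp add: u shape_ok_lists_def peak_at_def)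
  ultimately show ?thesis by (simp add: shape_ok_def)
qed

lemma dominated_list_nth:
  "dominated_list s t ws ps \<Longrightarrow> j < length ps \<Longrightarrow> j < length ws \<Longrightarrow> s * 6 ^ j * ws ! j \<le> t * 5 ^ j * ps ! j"
proof (induction s t ws ps arbitrary: j rule: dominated_list.induct)
  case (1 s t w ws p ps)
  then show ?case by (cases j) (auto simp: ac_simps)
qed auto

text \<open>\<open>rest_poly\<close> is not multiplied by a fixed polynomial as \<open>k\<close>
  grows, because \<open>F_poly (k + r)\<close> is a sum. Its two parts are: this one by
  \<open>(1 + x) (1 + 2 x)\<close>, \<open>rest2_poly\<close> by \<open>(1 + x)^2\<close>.\<close>

definition rest1_poly :: "nat \<Rightarrow> nat \<Rightarrow> int poly" where
  "rest1_poly k r = [:1, 1:] ^ k * [:1, 2:] ^ (k - 1) * ([:0, 1:] * (F3 * [:1, 2:] ^ (r + 1) + F4 * [:1, 1:] ^ r))"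

definition rest2_poly :: "nat \<Rightarrow> nat \<Rightarrow> int poly" where
  "rest2_poly k r = [:0, 0, 1:] * F3 * [:1, 1:] ^ (2 * k + r)"

lemma rest_poly_split:
  assumes "k \<ge> 1"
  shows "rest_poly k r = rest1_poly k r + rest2_poly k r"
proof -
  obtain l where k: "k = Suc l" using assms by (cases k) auto
  define x y z :: "int poly" where "x = [:0, 1:]" and "y = [:1, 1:]" and "z = [:1, 2:]"
  define a b c where "a = z ^ l" and "b = y ^ k" and "c = y ^ r"
  have x2: "[:0, 0, 1:] = x ^ 2" by (simp add: x_def power2_eq_square)
  have F: "F_poly (k + r) = z ^ r * (a * z) + x * (b * c)"
  proof -
    have "z ^ (k + r) = z ^ r * (a * z)" by (simp add: a_def k power_add)
    moreover have "y ^ (k + r) = b * c" by (simp add: b_def c_def power_add)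
    ultimately show ?thesis by (simp only: F_poly_def x_def y_def z_def)
  qed
  have "rest_poly k r = x * b * F3 * (z ^ r * (a * z) + x * (b * c)) + x * F4 * a * (b * c)"
    unfolding rest_poly_def F
    by (simp only: x_def[symmetric] y_def[symmetric] z_def[symmetric] b_def c_def a_def k diff_Suc_1 power_add)
  moreover have "rest1_poly k r = b * a * (x * (F3 * (z ^ r * z) + F4 * c))"
    unfolding rest1_poly_def
    by (simp only: x_def[symmetric] y_def[symmetric] z_def[symmetric] b_def c_def a_def k diff_Suc_1 power_add power_one_right)
  moreover have "rest2_poly k r = x ^ 2 * F3 * (b * b * c)"
    unfolding rest2_poly_def x2
    by (simp only: x_def[symmetric] y_def[symmetric] z_def[symmetric] b_def c_def mult_2 power_add)
  ultimately show ?thesis by (simp only: power2_eq_square) (simp add: algebra_simps)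
qed

lemma check_correct:
  assumes "check l k r hs us ws cs" "k \<ge> 3"
    and "Poly hs = F4 * [:1, 2:] ^ (2 * k + r - 1)" "Poly us = FU * [:1, 2:] ^ (2 * k + r - 1)"
    and "Poly ws = rest1_poly k r" "Poly cs = rest2_poly k r"
  shows "(\<forall>i. k \<le> i \<and> i < k + l \<and> (r = 2 \<longrightarrow> 4 \<le> i) \<longrightarrow> shape_ok i r) \<and> dominated (k + l) r"
  using assms
proof (induction l arbitrary: k hs us ws cs)
  case 0
  have rest: "rest_poly k r = Poly (add_list ws cs)"
    using 0 by (simp add: rest_poly_split Poly_add_list)
  have "6 ^ Suc j * coeff (rest_poly k r) j \<le> 5 ^ j * coeff (F4 * [:1, 2:] ^ (2 * k + r - 1)) j"
    if "j \<le> 2 * k + r + 4" for j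
  proof (cases "j < length (add_list ws cs)")
    case True
    have "dominated_list 6 1 (add_list ws cs) hs" "j < length hs"
      using 0(1) that by auto
    then show ?thesis
      using dominated_list_nth[of 6 1 "add_list ws cs" hs j] True
      by (simp only: rest 0(3)[symmetric] coeff_Poly_nth power_Suc mult_1)
  next
    case False
    have "0 \<le> coeff (F4 * [:1, 2:] ^ (2 * k + r - 1)) j"
      by (rule nonneg_polyD, intro nonneg_poly_mult nonneg_poly_power) (auto simp: F4_def)
    moreover have "coeff (rest_poly k r) j = 0"
      using False by (simp add: rest coeff_Poly_eq nth_default_beyond)
    ultimately show ?thesis by simp
  qed
  then have "dominated k r" unfolding dominated_def by blast
  then show ?case by auto
next
  case (Suc l)
  have e: "2 * Suc k + r - 1 = Suc (Suc (2 * k + r - 1))" "2 * Suc k + r = Suc (Suc (2 * k + r))"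
    "k = Suc (k - 1)" using Suc.prems by auto
  have rest1_poly: "rest1_poly (Suc k) r = [:1, 1:] * ([:1, 2:] * rest1_poly k r)"
  proof -
    have "[:1, 2::int:] ^ (Suc k - 1) = [:1, 2:] * [:1, 2:] ^ (k - 1)"
      using e(3) by (metis diff_Suc_1 power_Suc)
    then show ?thesis unfolding rest1_poly_def by (simp only: power_Suc ac_simps)
  qed
  \<comment> \<open>At \<open>k = 3\<close>, \<open>r = 2\<close> the claim is false: there the
    penultimate inequality of \<open>I(U)\<close> holds, since
    \<open>2939 * 1 <= 55^2\<close>.\<close>
  have "shape_ok k r" if "r = 2 \<longrightarrow> 4 \<le> k"
  proof (rule shape_ok_listsD)
    show "shape_ok_lists k r (add_list hs (add_list ws cs)) (add_list us (add_list ws cs))"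
      using Suc.prems(1) that by auto
    have "rest_poly k r = rest1_poly k r + rest2_poly k r" using Suc.prems(2) by (simp add: rest_poly_split)
    then show "H_coeff k r = coeff (Poly (add_list hs (add_list ws cs)))"
      "U_coeff k r = coeff (Poly (add_list us (add_list ws cs)))"
      by (simp_all only: H_coeff_def U_coeff_def Poly_add_list Suc.prems(3-6))
  qed
  moreover have "(\<forall>i. Suc k \<le> i \<and> i < Suc k + l \<and> (r = 2 \<longrightarrow> 4 \<le> i) \<longrightarrow> shape_ok i r) \<and> dominated (Suc k + l) r"
  proof (rule Suc.IH)
    show "check l (Suc k) r (mul_list 2 (mul_list 2 hs)) (mul_list 2 (mul_list 2 us))
       (mul_list 1 (mul_list 2 ws)) (mul_list 1 (mul_list 1 cs))"
      using Suc.prems(1) by simp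
    show "Poly (mul_list 2 (mul_list 2 hs)) = F4 * [:1, 2:] ^ (2 * Suc k + r - 1)"
      "Poly (mul_list 2 (mul_list 2 us)) = FU * [:1, 2:] ^ (2 * Suc k + r - 1)"
      unfolding Poly_mul_list Suc.prems(3,4) e(1) power_Suc by (simp_all only: ac_simps)
    show "Poly (mul_list 1 (mul_list 2 ws)) = rest1_poly (Suc k) r"
      unfolding Poly_mul_list Suc.prems(5) rest1_poly ..
    show "Poly (mul_list 1 (mul_list 1 cs)) = rest2_poly (Suc k) r"
      unfolding Poly_mul_list Suc.prems(6) rest2_poly_def e(2) power_Suc by (simp only: ac_simps)
  qed (use Suc.prems in simp)
  ultimately show ?case by (metis Suc_leI add_Suc add_Suc_right le_neq_implies_less)
qed

lemma Poly_funpow_mul_list: "Poly ((mul_list c ^^ t) xs) = [:1, c:] ^ t * Poly xs"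
  by (induction t) (simp_all only: funpow.simps o_apply id_apply Poly_mul_list power_0 power_Suc mult_1 mult.assoc)

text \<open>Starts at \<open>k = 3\<close>, where \<open>N = 5 + r\<close>, and takes 21 steps to
  the base case \<open>k = 24\<close> of the domination.\<close>

definition check_all :: "nat \<Rightarrow> bool" where
  "check_all r \<longleftrightarrow> check 21 3 r ((mul_list 2 ^^ (5 + r)) [1, 9, 28, 38, 20, 1])
     ((mul_list 2 ^^ (5 + r)) [1, 10, 36, 62, 52, 17])
     ((mul_list 1 ^^ 3) ((mul_list 2 ^^ 2) (0 # add_list ((mul_list 2 ^^ (r + 1)) [1, 7, 15, 11, 1]) ((mul_list 1 ^^ r) [1, 9, 28, 38, 20, 1]))))
     ((mul_list 1 ^^ (6 + r)) [0, 0, 1, 7, 15, 11, 1])"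

lemma check_all_correct:
  assumes "check_all r"
  shows "3 \<le> k \<Longrightarrow> k < 24 \<Longrightarrow> (r = 2 \<longrightarrow> 4 \<le> k) \<Longrightarrow> shape_ok k r" and "dominated 24 r"
proof -
  have P: "Poly (0 # xs) = [:0, 1:] * Poly xs" for xs :: "int list" by simp
  have F: "Poly [1, 9, 28, 38, 20, 1] = F4" "Poly [1, 10, 36, 62, 52, 17] = FU" "Poly [1, 7, 15, 11, 1] = F3"
    by (simp_all add: F3_def F4_def FU_def)
  have R: "Poly [0, 0, 1, 7, 15, 11, 1] = [:0, 0, 1:] * F3" by (simp add: F3_def)
  have "(\<forall>i. 3 \<le> i \<and> i < 3 + 21 \<and> (r = 2 \<longrightarrow> 4 \<le> i) \<longrightarrow> shape_ok i r) \<and> dominated (3 + 21) r"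
  proof (rule check_correct[OF assms[unfolded check_all_def]])
    have e: "2 * 3 + r - 1 = 5 + r" "6 + r - 1 = 5 + r" "2 * 3 + r = 6 + r" "(3::nat) - 1 = 2" by simp_all
    show "Poly ((mul_list 2 ^^ (5 + r)) [1, 9, 28, 38, 20, 1]) = F4 * [:1, 2:] ^ (2 * 3 + r - 1)"
      "Poly ((mul_list 2 ^^ (5 + r)) [1, 10, 36, 62, 52, 17]) = FU * [:1, 2:] ^ (2 * 3 + r - 1)"
      by (simp_all only: Poly_funpow_mul_list F e mult.commute)
    show "Poly ((mul_list 1 ^^ 3) ((mul_list 2 ^^ 2) (0 # add_list ((mul_list 2 ^^ (r + 1)) [1, 7, 15, 11, 1]) ((mul_list 1 ^^ r) [1, 9, 28, 38, 20, 1])))) = rest1_poly 3 r"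
      unfolding rest1_poly_def e Poly_funpow_mul_list P Poly_add_list F by (simp only: ac_simps)
    show "Poly ((mul_list 1 ^^ (6 + r)) [0, 0, 1, 7, 15, 11, 1]) = rest2_poly 3 r"
      unfolding rest2_poly_def e Poly_funpow_mul_list R by (simp only: ac_simps)
  qed simp
  then show "3 \<le> k \<Longrightarrow> k < 24 \<Longrightarrow> (r = 2 \<longrightarrow> 4 \<le> k) \<Longrightarrow> shape_ok k r" and "dominated 24 r" by auto
qed

subsection \<open>Large parameters\<close>

lemma dominated_ge:
  assumes "dominated 24 r" "24 \<le> k" "r \<le> 2"
  shows "dominated k r"
  using assms(2)
proof (induction k rule: dec_induct)
  case (step k)
  then show ?case using dominated_Suc[of k r] assms(3) by simp
qed (rule assms(1))

lemma exponential_ge_linear: "24 \<le> k \<Longrightarrow> 2 * int k + 41 \<le> 2 ^ (k - 4)"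
proof (induction k rule: dec_induct)
  case (step k)
  then have "Suc k - 4 = Suc (k - 4)" by simp
  then have "(2::int) ^ (Suc k - 4) = 2 * 2 ^ (k - 4)" by (simp only: power_Suc)
  then show ?case using step by simp
qed simp

text \<open>With \<open>dominated\<close>, it bounds the rest by the fraction
  \<open>1 / (15 j)\<close> of the main coefficient. Near the mode \<open>3 j >= 2 N + 5\<close> and
  \<open>N >= 47\<close>, whence 33.\<close>

lemma linear_times_geometric_le: "33 \<le> j \<Longrightarrow> 15 * int j * 5 ^ j \<le> 6 ^ Suc j"
proof (induction j rule: dec_induct)
  case (step j)
  have "15 * int (Suc j) * 5 ^ Suc j = (5 * (15 * (int j + 1))) * 5 ^ j" by simp
  also have "\<dots> \<le> (6 * (15 * int j)) * 5 ^ j"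
    using step(1) by (intro mult_right_mono) auto
  also have "\<dots> = 6 * (15 * int j * 5 ^ j)" by simp
  also have "\<dots> \<le> 6 * 6 ^ Suc j" using step.IH by (intro mult_left_mono) auto
  finally show ?case by simp
qed simp

lemma F4_le_FU: "coeff (F4 * [:1, 2:] ^ N) j \<le> coeff (FU * [:1, 2:] ^ N) j"
proof -
  have "FU * [:1, 2:] ^ N = F4 * [:1, 2:] ^ N + [:0, 1:] * [:1, 2:] ^ 4 * [:1, 2:] ^ N"
    by (simp only: FU_eq distrib_right)
  moreover have "nonneg_poly ([:0, 1:] * [:1, 2:] ^ 4 * [:1, 2:] ^ N)"
    by (intro nonneg_poly_mult nonneg_poly_power) auto
  ultimately show ?thesis by (simp add: nonneg_poly_def)
qed

text \<open>Used with \<open>F4\<close> and leading coefficients 1, 20 for \<open>H\<close>, and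
  with \<open>FU\<close> and 17, 52 for \<open>I(U)\<close>. By \<open>P_ge\<close> the domination
  by the \<open>F4\<close> term serves both.\<close>

locale large_case =
  fixes k r N n :: nat and P :: "int poly" and a b :: int
  assumes k: "24 \<le> k" and r: "r \<le> 2" and N: "N = 2 * k + r - 1" and n: "n = 2 * k + r + 4"
    and dom: "dominated k r"
    and P_ge: "\<And>j. coeff (F4 * [:1, 2:] ^ N) j \<le> coeff (P * [:1, 2:] ^ N) j"
    and ulc: "ultra_log_concave 5 (\<lambda>j. real_of_int (coeff P j))"
    and top: "top2 P 4 a b" and a: "1 \<le> a" and b: "b \<le> 20 * a"
begin

definition p :: "nat \<Rightarrow> int" where "p = coeff (P * [:1, 2:] ^ N)"
definition w :: "nat \<Rightarrow> int" where "w = coeff (rest_poly k r)"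

lemma nN: "n = N + 5" and N_ge: "47 \<le> N"
  using k by (auto simp: n N)

lemma coeff_sum: "coeff (P * [:1, 2:] ^ N + rest_poly k r) j = p j + w j"
  by (simp add: p_def w_def del: mult_pCons_left)

lemma ulc_p: "ultra_log_concave n (\<lambda>j. real_of_int (p j))"
  unfolding p_def nN by (rule ultra_log_concave_main[OF ulc])

lemma p_pos: "j \<le> n \<Longrightarrow> 0 < p j"
  using ultra_log_concaveD(1)[OF ulc_p] by simp

lemma w_nonneg: "0 \<le> w j"
  unfolding w_def by (rule nonneg_polyD[OF nonneg_rest_poly])

lemma w_dom: "j \<le> n \<Longrightarrow> 6 ^ Suc j * w j \<le> 5 ^ j * p j"
proof -
  assume "j \<le> n"
  then have "6 ^ Suc j * w j \<le> 5 ^ j * coeff (F4 * [:1, 2:] ^ N) j"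
    using dom by (auto simp: dominated_def w_def n N)
  also have "\<dots> \<le> 5 ^ j * p j" unfolding p_def by (intro mult_left_mono P_ge) auto
  finally show ?thesis .
qed

lemma w_le_p:
  assumes "j \<le> n"
  shows "w j \<le> p j"
proof -
  have "6 ^ Suc j * w j \<le> 5 ^ j * p j" by (rule w_dom[OF assms])
  also have "\<dots> \<le> 6 ^ Suc j * p j"
  proof (rule mult_right_mono)
    have "(5::int) ^ j \<le> 6 ^ j" by (rule power_mono) auto
    also have "\<dots> \<le> 6 ^ Suc j" by simp
    finally show "(5::int) ^ j \<le> 6 ^ Suc j" .
  qed (use p_pos[OF assms] in simp)
  finally show ?thesis by (simp add: mult_le_cancel_left)
qed

lemma log_concave_below:
  assumes "1 \<le> j" "j < n"
  shows "(p (j - 1) + w (j - 1)) * (p (j + 1) + w (j + 1)) \<le> (p j + w j)\<^sup>2"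
proof -
  have "6 ^ Suc j * real_of_int (w j) \<le> 5 ^ j * real_of_int (p j)" if "j \<le> n" for j
  proof -
    have "real_of_int (6 ^ Suc j * w j) \<le> real_of_int (5 ^ j * p j)"
      using w_dom[OF that] by (simp only: of_int_le_iff)
    then show ?thesis by simp
  qed
  then have "(real_of_int (p (j - 1)) + real_of_int (w (j - 1))) * (real_of_int (p (j + 1)) + real_of_int (w (j + 1)))
      \<le> (real_of_int (p j) + real_of_int (w j))\<^sup>2"
    using w_nonneg by (intro log_concave_perturbed[OF ulc_p _ _ assms]) auto
  then show ?thesis
    by (simp only: of_int_add[symmetric] of_int_mult[symmetric] of_int_power[symmetric] of_int_le_iff)
qed

lemma p_top: "p n = a * 2 ^ N" "2 * p (n - 1) \<le> (int N + 40) * p n" "j > n \<Longrightarrow> p j = 0"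
proof -
  obtain M where M: "N = Suc M" using N_ge by (cases N) auto
  have t: "top2 (P * [:1, 2:] ^ N) (Suc (4 + M)) (a * 2 ^ Suc M) (a * (int (Suc M) * 2 ^ M) + b * 2 ^ Suc M)"
    unfolding M by (rule top2_mult[OF top top2_linear_power])
  moreover have idx: "Suc (Suc (4 + M)) = n" "Suc (4 + M) = n - 1" by (simp_all add: nN M)
  ultimately have pn: "p n = a * 2 ^ N" and "p (n - 1) = a * (int N * 2 ^ M) + b * 2 ^ N"
    and deg: "degree (P * [:1, 2:] ^ N) \<le> n"
    unfolding top2_def idx M[symmetric] p_def[symmetric] by auto
  show "p n = a * 2 ^ N" by (rule pn)
  from \<open>p (n - 1) = _\<close>
  have "2 * p (n - 1) = (a * int N + 2 * b) * 2 ^ N" by (simp add: M algebra_simps)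
  also have "\<dots> \<le> (a * int N + 40 * a) * 2 ^ N" using b by (intro mult_right_mono) auto
  also have "\<dots> = (int N + 40) * p n" by (simp add: pn algebra_simps)
  finally show "2 * p (n - 1) \<le> (int N + 40) * p n" .
  show "j > n \<Longrightarrow> p j = 0"
    using deg unfolding p_def by (intro coeff_eq_0) simp
qed

lemma linear_le_power: "int (2 * k + r + 11) \<le> 2 ^ (k - 1)"
proof -
  have "(2::int) ^ (k - 4) \<le> 2 ^ (k - 1)" by (intro power_increasing) auto
  moreover have "int (2 * k + r + 11) \<le> 2 * int k + 41" using r by simp
  ultimately show ?thesis using exponential_ge_linear[OF k] by linarith
qed

lemma w_top: "w (n + 1) = 2 ^ (k - 1) + 2 ^ (k + r) + int (2 * k + r + 11)" "w (n + 2) = 1"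
  "w (n + 1) \<le> 2 ^ (k + r + 1)"
proof -
  show w1: "w (n + 1) = 2 ^ (k - 1) + 2 ^ (k + r) + int (2 * k + r + 11)" and "w (n + 2) = 1"
    using top2_rest_poly[of k r] k by (simp_all add: top2_def w_def n eval_nat_numeral)
  have "2 * (2::int) ^ (k - 1) = 2 ^ k" using k by (cases k) auto
  moreover have "(2::int) ^ k \<le> 2 ^ (k + r)" by simp
  moreover have "(2::int) ^ (k + r + 1) = 2 * 2 ^ (k + r)" by simp
  ultimately show "w (n + 1) \<le> 2 ^ (k + r + 1)" unfolding w1 using linear_le_power by linarith
qed

lemma sum_top: "p (n + 1) + w (n + 1) = 2 ^ (k - 1) + 2 ^ (k + r) + int (2 * k + r + 11)"
  "p (n + 2) + w (n + 2) = 1"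
  using p_top(3)[of "n + 1"] p_top(3)[of "n + 2"] w_top(1,2) by simp_all

text \<open>The upper neighbour has no main part here, so the margin is of no use. Instead
  \<open>p (n - 1) / p n\<close> is at most linear in \<open>N\<close>, while
  \<open>w (n + 1) / p n\<close> is exponentially small.\<close>

lemma log_concave_top: "(p (n - 1) + w (n - 1)) * (p (n + 1) + w (n + 1)) \<le> (p n + w n)\<^sup>2"
proof -
  have pos: "0 < p n" "0 < p (n - 1)" by (simp_all add: p_pos)
  have "(p (n - 1) + w (n - 1)) * (p (n + 1) + w (n + 1)) \<le> (2 * p (n - 1)) * 2 ^ (k + r + 1)"
    using w_le_p[of "n - 1"] w_top(3) w_nonneg pos by (intro mult_mono) (auto simp: p_top(3))
  also have "\<dots> \<le> ((int N + 40) * p n) * 2 ^ (k + r + 1)"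
    using p_top(2) by (intro mult_right_mono) auto
  also have "\<dots> = p n * ((int N + 40) * 2 ^ (k + r + 1))" by simp
  also have "\<dots> \<le> p n * p n"
  proof (rule mult_left_mono)
    have "int N + 40 \<le> 2 ^ (k - 4)" using exponential_ge_linear[OF k] r k by (simp add: N)
    then have "(int N + 40) * 2 ^ (k + r + 1) \<le> 2 ^ (k - 4) * 2 ^ (k + r + 1)"
      by (intro mult_right_mono) auto
    also have "\<dots> = 2 ^ (k - 4 + (k + r + 1))" by (rule power_add[symmetric])
    also have "\<dots> \<le> 2 ^ N" using k by (intro power_increasing) (auto simp: N)
    also have "\<dots> \<le> a * 2 ^ N" using a by simp
    also have "\<dots> = p n" by (simp add: p_top)
    finally show "(int N + 40) * 2 ^ (k + r + 1) \<le> p n" .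
  qed (use pos in simp)
  also have "\<dots> \<le> (p n + w n)\<^sup>2"
    using pos w_nonneg[of n] by (simp add: power2_eq_square mult_mono)
  finally show ?thesis .
qed

text \<open>At a neighbour of \<open>m\<close> the rest is at most \<open>1 / (10 N)\<close> of the
  main coefficient, which is the relative room given by the last two hypotheses; the rest at
  \<open>m\<close> itself only helps.\<close>

lemma peakI:
  assumes "2 * N + 8 \<le> 3 * m" "m + 1 \<le> n"
    and "(10 * int N + 1) * p (m - 1) \<le> 10 * int N * p m"
    and "(10 * int N + 1) * p (m + 1) \<le> 10 * int N * p m"
  shows "peak_at (\<lambda>j. p j + w j) m"
proof -
  have "p j + w j \<le> p m + w m" if j: "2 * N + 5 \<le> 3 * j" "j \<le> n"
    and le: "(10 * int N + 1) * p j \<le> 10 * int N * p m" for j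
  proof -
    have "6 ^ Suc j * (10 * int N * w j) = 10 * int N * (6 ^ Suc j * w j)" by simp
    also have "\<dots> \<le> 10 * int N * (5 ^ j * p j)" using w_dom[OF j(2)] by (intro mult_left_mono) auto
    also have "\<dots> = (10 * int N * 5 ^ j) * p j" by simp
    also have "\<dots> \<le> 6 ^ Suc j * p j"
    proof (rule mult_right_mono)
      have "10 * int N * 5 ^ j \<le> 15 * int j * 5 ^ j" using j by (intro mult_right_mono) auto
      also have "\<dots> \<le> 6 ^ Suc j" using j N_ge by (intro linear_times_geometric_le) auto
      finally show "10 * int N * 5 ^ j \<le> 6 ^ Suc j" .
    qed (use p_pos[OF j(2)] in simp)
    finally have "10 * int N * w j \<le> p j" by (simp add: mult_le_cancel_left)
    then have "10 * int N * (p j + w j) \<le> 10 * int N * p m" using le by (simp add: algebra_simps)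
    then have "p j + w j \<le> p m" using N_ge by (simp add: mult_le_cancel_left)
    then show ?thesis using w_nonneg[of m] by simp
  qed
  from this[of "m - 1"] this[of "m + 1"] show ?thesis
    using assms N_ge by (auto simp: peak_at_def)
qed

end

text \<open>A peak at \<open>m\<close> uses the first part at \<open>J = m\<close> and the second at
  \<open>J = m + 1\<close>.\<close>

lemma window_transfer:
  fixes P :: "int poly"
  assumes P: "degree P \<le> 5" and J: "6 \<le> J" "J \<le> N"
    and "real J = x" "real N - real J = y"
  defines "W \<equiv> window_sum (\<lambda>i. real_of_int (coeff P i)) x y"
  shows "(10 * real N + 1) * W 1 \<le> 10 * real N * W 0 \<Longrightarrow>
      (10 * int N + 1) * coeff (P * [:1, 2:] ^ N) (J - 1) \<le> 10 * int N * coeff (P * [:1, 2:] ^ N) J"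
    and "(10 * real N + 1) * W 0 \<le> 10 * real N * W 1 \<Longrightarrow>
      (10 * int N + 1) * coeff (P * [:1, 2:] ^ N) J \<le> 10 * int N * coeff (P * [:1, 2:] ^ N) (J - 1)"
proof -
  obtain D :: real where D: "D > 0"
    "real_of_int (coeff (P * [:1, 2:] ^ N) J) = D * W 0"
    "real_of_int (coeff (P * [:1, 2:] ^ N) (J - 1)) = D * W 1"
    using coeff_main_window[OF P J] assms by metis
  let ?c = "coeff (P * [:1, 2:] ^ N)"
  show "(10 * int N + 1) * ?c (J - 1) \<le> 10 * int N * ?c J" if "(10 * real N + 1) * W 1 \<le> 10 * real N * W 0"
  proof -
    have "real_of_int ((10 * int N + 1) * ?c (J - 1)) = D * ((10 * real N + 1) * W 1)"
      unfolding of_int_mult D by simp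
    also have "\<dots> \<le> D * (10 * real N * W 0)" using D that by (intro mult_left_mono) auto
    also have "\<dots> = real_of_int (10 * int N * ?c J)" unfolding of_int_mult D by simp
    finally show ?thesis by (simp only: of_int_le_iff)
  qed
  show "(10 * int N + 1) * ?c J \<le> 10 * int N * ?c (J - 1)" if "(10 * real N + 1) * W 0 \<le> 10 * real N * W 1"
  proof -
    have "real_of_int ((10 * int N + 1) * ?c J) = D * ((10 * real N + 1) * W 0)"
      unfolding of_int_mult D by simp
    also have "\<dots> \<le> D * (10 * real N * W 1)" using D that by (intro mult_left_mono) auto
    also have "\<dots> = real_of_int (10 * int N * ?c (J - 1))" unfolding of_int_mult D by simp
    finally show ?thesis by (simp only: of_int_le_iff)
  qed
qed

lemma N_residue:
  assumes "47 \<le> (N::nat)"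
  obtains t where "N = 47 + 3 * t" | t where "N = 48 + 3 * t" | t where "N = 49 + 3 * t"
proof -
  have "N = 47 + (N - 47) mod 3 + 3 * ((N - 47) div 3)" using assms by simp
  moreover have "(N - 47) mod 3 = 0 \<or> (N - 47) mod 3 = 1 \<or> (N - 47) mod 3 = 2" by linarith
  ultimately consider "N = 47 + 3 * ((N - 47) div 3)" | "N = 48 + 3 * ((N - 47) div 3)" | "N = 49 + 3 * ((N - 47) div 3)"
    by fastforce
  then show ?thesis using that by cases
qed

lemma degree_F4_FU: "degree F4 \<le> 5" "degree FU \<le> 5"
  by (simp_all add: F4_def FU_def)

lemma F4_peak:
  assumes "47 \<le> N" "m = (2 * N + 10) div 3"
  defines "c \<equiv> coeff (F4 * [:1, 2:] ^ N)"
  shows "(10 * int N + 1) * c (m - 1) \<le> 10 * int N * c m"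
    and "(10 * int N + 1) * c (m + 1) \<le> 10 * int N * c m"
proof -
  have "(10 * int N + 1) * c (m - 1) \<le> 10 * int N * c m \<and> (10 * int N + 1) * c (m + 1) \<le> 10 * int N * c m"
    using assms(1)
  proof (cases rule: N_residue)
    case (1 t)
    then have m: "m = 34 + 2 * t" using assms(2) by simp
    show ?thesis unfolding c_def
      using window_transfer(1)[OF degree_F4_FU(1), of m N "34 + 2 * real t" "13 + real t"] window_F4_47_left[of "real t"]
        window_transfer(2)[OF degree_F4_FU(1), of "m + 1" N "35 + 2 * real t" "12 + real t"] window_F4_47_right[of "real t"]
      by (simp add: m 1 del: mult_pCons_left)
  next
    case (2 t)
    then have m: "m = 35 + 2 * t" using assms(2) by simp
    show ?thesis unfolding c_def
      using window_transfer(1)[OF degree_F4_FU(1), of m N "35 + 2 * real t" "13 + real t"] window_F4_48_left[of "real t"]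
        window_transfer(2)[OF degree_F4_FU(1), of "m + 1" N "36 + 2 * real t" "12 + real t"] window_F4_48_right[of "real t"]
      by (simp add: m 2 del: mult_pCons_left)
  next
    case (3 t)
    then have m: "m = 36 + 2 * t" using assms(2) by simp
    show ?thesis unfolding c_def
      using window_transfer(1)[OF degree_F4_FU(1), of m N "36 + 2 * real t" "13 + real t"] window_F4_49_left[of "real t"]
        window_transfer(2)[OF degree_F4_FU(1), of "m + 1" N "37 + 2 * real t" "12 + real t"] window_F4_49_right[of "real t"]
      by (simp add: m 3 del: mult_pCons_left)
  qed
  then show "(10 * int N + 1) * c (m - 1) \<le> 10 * int N * c m"
    "(10 * int N + 1) * c (m + 1) \<le> 10 * int N * c m" by blast+
qed

lemma FU_peak:
  assumes "47 \<le> N" "m = (2 * N + 11) div 3"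
  defines "c \<equiv> coeff (FU * [:1, 2:] ^ N)"
  shows "(10 * int N + 1) * c (m - 1) \<le> 10 * int N * c m"
    and "(10 * int N + 1) * c (m + 1) \<le> 10 * int N * c m"
proof -
  have "(10 * int N + 1) * c (m - 1) \<le> 10 * int N * c m \<and> (10 * int N + 1) * c (m + 1) \<le> 10 * int N * c m"
    using assms(1)
  proof (cases rule: N_residue)
    case (1 t)
    then have m: "m = 35 + 2 * t" using assms(2) by simp
    show ?thesis unfolding c_def
      using window_transfer(1)[OF degree_F4_FU(2), of m N "35 + 2 * real t" "12 + real t"] window_FU_47_left[of "real t"]
        window_transfer(2)[OF degree_F4_FU(2), of "m + 1" N "36 + 2 * real t" "11 + real t"] window_FU_47_right[of "real t"]
      by (simp add: m 1 del: mult_pCons_left)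
  next
    case (2 t)
    then have m: "m = 35 + 2 * t" using assms(2) by simp
    show ?thesis unfolding c_def
      using window_transfer(1)[OF degree_F4_FU(2), of m N "35 + 2 * real t" "13 + real t"] window_FU_48_left[of "real t"]
        window_transfer(2)[OF degree_F4_FU(2), of "m + 1" N "36 + 2 * real t" "12 + real t"] window_FU_48_right[of "real t"]
      by (simp add: m 2 del: mult_pCons_left)
  next
    case (3 t)
    then have m: "m = 36 + 2 * t" using assms(2) by simp
    show ?thesis unfolding c_def
      using window_transfer(1)[OF degree_F4_FU(2), of m N "36 + 2 * real t" "13 + real t"] window_FU_49_left[of "real t"]
        window_transfer(2)[OF degree_F4_FU(2), of "m + 1" N "37 + 2 * real t" "12 + real t"] window_FU_49_right[of "real t"]
      by (simp add: m 3 del: mult_pCons_left)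
  qed
  then show "(10 * int N + 1) * c (m - 1) \<le> 10 * int N * c m"
    "(10 * int N + 1) * c (m + 1) \<le> 10 * int N * c m" by blast+
qed

lemma shape_ok_large:
  assumes k: "24 \<le> k" and r: "r \<le> 2" and dom: "dominated k r"
  shows "shape_ok k r"
proof -
  define N n where "N = 2 * k + r - 1" and "n = 2 * k + r + 4"
  have topF4: "top2 F4 4 1 20" and topFU: "top2 FU 4 17 52"
    by (simp_all add: top2_def F4_def FU_def eval_nat_numeral)
  interpret H: large_case k r N n F4 1 20
    by unfold_locales (use assms ulc_F4 topF4 in \<open>simp_all add: N_def n_def del: mult_pCons_left\<close>)
  interpret U: large_case k r N n FU 17 52
    by unfold_locales (use assms ulc_FU topFU F4_le_FU in \<open>simp_all add: N_def n_def del: mult_pCons_left\<close>)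
  have h: "H_coeff k r = (\<lambda>j. H.p j + H.w j)"
    unfolding H_coeff_def N_def[symmetric] by (rule ext) (rule H.coeff_sum)
  have u: "U_coeff k r = (\<lambda>j. U.p j + U.w j)"
    unfolding U_coeff_def N_def[symmetric] by (rule ext) (rule U.coeff_sum)
  have n1: "2 * k + r + 5 = n + 1" "2 * k + r + 6 = n + 2" by (simp_all add: n_def)
  have pow: "(2::int) ^ k = 2 * 2 ^ (k - 1)" using k by (cases k) auto
  have N2: "(2::int) ^ N = 2 * 2 ^ r * (2 ^ (k - 1))\<^sup>2"
  proof -
    have e: "N = Suc (r + (k - 1) * 2)" using k by (simp add: N_def)
    show ?thesis unfolding e by (simp only: power_Suc power_add power_mult mult.assoc)
  qed
  let ?X = "2 ^ (k - 1) :: int"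
  \<comment> \<open>By \<open>N2\<close> the left side is at most \<open>4 * 2^r\<close> times
    \<open>?X^2\<close>, and the single summand \<open>2^(k + r)\<close> on the right already
    contributes \<open>4 * 4^r\<close> times \<open>?X^2\<close>.\<close>
  have h2: "(H.p n + H.w n) * (H.p (n + 2) + H.w (n + 2)) \<le> (H.p (n + 1) + H.w (n + 1))\<^sup>2"
  proof -
    have "(H.p n + H.w n) * (H.p (n + 2) + H.w (n + 2)) \<le> 2 * 2 ^ N"
      unfolding H.sum_top using H.w_le_p[of n] H.p_top(1) by simp
    also have "\<dots> = 4 * 2 ^ r * ?X\<^sup>2" by (simp add: N2)
    also have "\<dots> \<le> 4 * (2 ^ r * 2 ^ r) * ?X\<^sup>2" by (intro mult_right_mono mult_left_mono) auto
    also have "\<dots> = (2 ^ (k + r))\<^sup>2" by (simp add: power_add pow power2_eq_square)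
    also have "\<dots> \<le> (H.p (n + 1) + H.w (n + 1))\<^sup>2"
      unfolding H.sum_top by (intro power_mono) simp_all
    finally show ?thesis .
  qed
  have u2: "(U.p (n + 1) + U.w (n + 1))\<^sup>2 < (U.p n + U.w n) * (U.p (n + 2) + U.w (n + 2))"
  proof -
    have "U.p (n + 1) + U.w (n + 1) \<le> ?X * (2 + 2 * 2 ^ r)"
    proof -
      have "?X * (2 + 2 * 2 ^ r) = ?X + 2 ^ (k + r) + ?X" by (simp add: power_add pow algebra_simps)
      then show ?thesis unfolding U.sum_top using U.linear_le_power by linarith
    qed
    moreover have "0 \<le> U.p (n + 1) + U.w (n + 1)" unfolding U.sum_top by simp
    ultimately have "(U.p (n + 1) + U.w (n + 1))\<^sup>2 \<le> (?X * (2 + 2 * 2 ^ r))\<^sup>2"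
      by (intro power_mono)
    also have "\<dots> = (2 + 2 * 2 ^ r)\<^sup>2 * ?X\<^sup>2" by (simp add: power_mult_distrib)
    also have "\<dots> < (34 * 2 ^ r) * ?X\<^sup>2"
    proof (rule mult_strict_right_mono)
      \<comment> \<open>These are \<open>16 < 34\<close>, \<open>36 < 68\<close> and
        \<open>100 < 136\<close>; at \<open>r = 3\<close> it would be 324 against 272.\<close>
      show "(2 + 2 * 2 ^ r)\<^sup>2 < (34 * 2 ^ r :: int)"
        using r by (auto simp: numeral_2_eq_2 le_Suc_eq)
    qed simp
    also have "\<dots> = U.p n" by (simp add: U.p_top(1) N2)
    also have "\<dots> \<le> (U.p n + U.w n) * (U.p (n + 2) + U.w (n + 2))"
      unfolding U.sum_top using U.w_nonneg[of n] by simp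
    finally show ?thesis .
  qed
  have hj: "(H.p (j - 1) + H.w (j - 1)) * (H.p (j + 1) + H.w (j + 1)) \<le> (H.p j + H.w j)\<^sup>2"
    if "1 \<le> j" "j \<le> n + 1" for j
  proof -
    consider "j < n" | "j = n" | "j = n + 1" using \<open>j \<le> n + 1\<close> by linarith
    then show ?thesis using H.log_concave_below[of j] H.log_concave_top h2 that by cases (auto simp: add.commute)
  qed
  have uj: "(U.p (j - 1) + U.w (j - 1)) * (U.p (j + 1) + U.w (j + 1)) \<le> (U.p j + U.w j)\<^sup>2"
    if "1 \<le> j" "j \<le> n" for j
    using U.log_concave_below[of j] U.log_concave_top that by (cases "j < n") auto
  have mH: "H_mode k r = (2 * N + 10) div 3" using k by (simp add: H_mode_def N_def algebra_simps)
  have mU: "U_mode k r = (2 * N + 11) div 3" using k by (simp add: U_mode_def N_def algebra_simps)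
  have nN: "n = N + 5" "47 \<le> N" by (fact H.nN H.N_ge)+
  have "peak_at (\<lambda>j. H.p j + H.w j) (H_mode k r)"
  proof (rule H.peakI)
    show "2 * N + 8 \<le> 3 * H_mode k r" "H_mode k r + 1 \<le> n" using nN unfolding mH by auto
  qed (use F4_peak[OF nN(2) mH] in \<open>auto simp: H.p_def\<close>)
  moreover have "peak_at (\<lambda>j. U.p j + U.w j) (U_mode k r)"
  proof (rule U.peakI)
    show "2 * N + 8 \<le> 3 * U_mode k r" "U_mode k r + 1 \<le> n" using nN unfolding mU by auto
  qed (use FU_peak[OF nN(2) mU] in \<open>auto simp: U.p_def\<close>)
  ultimately show ?thesis
    unfolding shape_ok_def h u n1 n_def[symmetric] using hj uj u2 by (auto simp: not_le)
qed

subsection \<open>Conclusion\<close>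

lemma independence_poly_T3:
  "independence_poly (T3 m n) = F_poly 3 * (F_poly m * F_poly n) + [:0, 1:] * [:1, 2:] ^ (3 + m + n)"
  using simple_graph_T3[of m n]
  by (simp add: independence_number_and_poly(2) simple_graph_def indep_poly_T3 del: mult_pCons_left)

lemma H_poly_eq:
  assumes "k \<ge> 1"
  shows "H_poly k r = F4 * [:1, 2:] ^ (2 * k + r - 1) + rest_poly k r"
proof -
  have "3 + (k - 1) + 0 = k + 2" using assms by simp
  then show ?thesis
    unfolding H_poly_def G_poly_def independence_poly_T3 decomposition[OF assms, symmetric] F_poly_0 by (simp only:)
qed

lemma independence_poly_U:
  assumes "k \<ge> 1"
  shows "independence_poly (U_graph k r) = FU * [:1, 2:] ^ (2 * k + r - 1) + rest_poly k r"
    and "independence_number (U_graph k r) = degree (independence_poly (U_graph k r))"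
proof -
  have fin: "finite (verts (U_graph k r))"
    using simple_graph_U_graph[OF assms, of r] by (simp add: simple_graph_def)
  note U = independence_number_and_poly[OF fin]
  show "independence_number (U_graph k r) = degree (independence_poly (U_graph k r))"
    using U by simp
  have "2 * k + r + 3 = 4 + (2 * k + r - 1)" using assms by simp
  then have e: "[:1, 2:] ^ (2 * k + r + 3) = [:1, 2::int:] ^ 4 * [:1, 2:] ^ (2 * k + r - 1)"
    by (simp only: power_add)
  show "independence_poly (U_graph k r) = FU * [:1, 2:] ^ (2 * k + r - 1) + rest_poly k r"
    unfolding U(2) indep_poly_U[OF assms] decomposition[OF assms] FU_eq e
    by (simp only: distrib_left distrib_right ac_simps)
qed

lemma coeff_main_plus_rest:
  fixes k r j :: nat
  assumes k: "k \<ge> 1" and ulc: "ultra_log_concave 5 (\<lambda>j. real_of_int (coeff P j))" and "degree P \<le> 5"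
  defines "Q \<equiv> P * [:1, 2:] ^ (2 * k + r - 1) + rest_poly k r"
  shows "degree Q = 2 * k + r + 6" "j \<le> 2 * k + r + 6 \<Longrightarrow> 0 < coeff Q j" "0 \<le> coeff Q j"
    "coeff Q (2 * k + r + 6) = 1"
proof -
  let ?N = "2 * k + r - 1"
  let ?p = "P * [:1, 2:] ^ ?N"
  have N: "?N + 5 = 2 * k + r + 4" using k by simp
  have "degree ?p \<le> degree P + degree ([:1, 2::int:] ^ ?N)" by (rule degree_mult_le)
  also have "\<dots> \<le> 5 + ?N"
    using assms(3) top1_linear_power[of 2 ?N] by (intro add_mono) (auto simp: top1_def)
  finally have dp: "degree ?p \<le> 2 * k + r + 4" using N by linarith
  have top: "degree (rest_poly k r) \<le> 2 * k + r + 6" "coeff (rest_poly k r) (2 * k + r + 6) = 1"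
    "coeff (rest_poly k r) (2 * k + r + 5) > 0"
    using top2_rest_poly[OF k, of r] by (auto simp: top2_def eval_nat_numeral add_pos_nonneg)
  have p0: "coeff ?p i = 0" if "i > 2 * k + r + 4" for i
    using dp that by (intro coeff_eq_0) simp
  have pp: "0 < coeff ?p i" if "i \<le> 2 * k + r + 4" for i
    using ultra_log_concaveD(1)[OF ultra_log_concave_main[OF ulc, of ?N], of i] that unfolding N by simp
  have r0: "0 \<le> coeff (rest_poly k r) i" for i by (rule nonneg_polyD[OF nonneg_rest_poly])
  show top1: "coeff Q (2 * k + r + 6) = 1"
    unfolding Q_def coeff_add using p0[of "2 * k + r + 6"] top by simp
  have "degree Q \<le> 2 * k + r + 6" unfolding Q_def by (intro degree_add_le top) (use dp in simp)
  moreover have "2 * k + r + 6 \<le> degree Q" by (rule le_degree) (simp add: top1)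
  ultimately show deg: "degree Q = 2 * k + r + 6" by simp
  show pos: "0 < coeff Q j" if "j \<le> 2 * k + r + 6" for j
  proof -
    from that consider "j \<le> 2 * k + r + 4" | "j = 2 * k + r + 5" | "j = 2 * k + r + 6" by linarith
    then show ?thesis
      unfolding Q_def coeff_add using pp[of j] r0[of j] top(2,3) p0[of j] by cases (auto intro: add_pos_nonneg)
  qed
  show "0 \<le> coeff Q j"
  proof (cases "j \<le> 2 * k + r + 6")
    case True
    then show ?thesis by (simp add: pos less_imp_le)
  next
    case False
    then show ?thesis using deg by (simp add: coeff_eq_0)
  qed
qed

text \<open>Ratios of neighbouring terms decrease, so the two comparisons at \<open>m\<close> spread
  in both directions. The bound \<open>d\<close> is free because log-concavity of
  \<open>I(U)\<close> ends before its last coefficient.\<close>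

lemma unimodal_if_log_concave_peak:
  fixes a :: "nat \<Rightarrow> int"
  assumes pos: "\<And>j. j \<le> d \<Longrightarrow> 0 < a j"
    and lc: "\<And>j. 1 \<le> j \<Longrightarrow> j < d \<Longrightarrow> a (j - 1) * a (j + 1) \<le> (a j)\<^sup>2"
    and peak: "peak_at a m" and m: "1 \<le> m" "m < d"
  shows "i < m \<Longrightarrow> a i \<le> a (i + 1)" and "m \<le> i \<Longrightarrow> i < d \<Longrightarrow> a (i + 1) \<le> a i"
proof -
  have lc': "a i * a (Suc (Suc i)) \<le> a (Suc i) * a (Suc i)" if "Suc i < d" for i
    using lc[of "Suc i"] that by (simp add: power2_eq_square)
  show "a i \<le> a (i + 1)" if "i < m"
  proof -
    have "i \<le> m - 1" using that by simp
    then show ?thesis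
    proof (induction i rule: inc_induct)
      case base
      then show ?case using peak m by (simp add: peak_at_def)
    next
      case (step i)
      have "a i * a (Suc (Suc i)) \<le> a (Suc i) * a (Suc i)" using step m by (intro lc') simp
      also have "\<dots> \<le> a (Suc i) * a (Suc (Suc i))"
        using step m by (intro mult_left_mono less_imp_le[OF pos]) auto
      finally show ?case using pos[of "Suc (Suc i)"] step m by (simp add: mult_le_cancel_right)
    qed
  qed
  show "a (i + 1) \<le> a i" if "m \<le> i" "i < d"
    using that
  proof (induction i rule: dec_induct)
    case base
    then show ?case using peak by (simp add: peak_at_def)
  next
    case (step i)
    have "a i * a (Suc (Suc i)) \<le> a (Suc i) * a (Suc i)" using step by (intro lc') simp
    also have "\<dots> \<le> a i * a (Suc i)"
      using step pos[of "Suc i"] by (intro mult_right_mono) auto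
    finally show ?case using pos[of i] step by (simp add: mult_le_cancel_left)
  qed
qed

text \<open>The ratio \<open>2 (M - j) / (j + 1)\<close> of neighbouring coefficients crosses 1 at
  \<open>3 j + 1 = 2 M\<close>.\<close>

lemma E_poly_unimodal: "unimodal_with_mode (E_poly k r) ((4 * k + 2 * r + 10) div 3)"
proof -
  define M where "M = 2 * k + r + 3"
  define m where "m = (2 * M + 4) div 3"
  have c0: "coeff (E_poly k r) 0 = 0" by (simp add: E_poly_def)
  have c: "coeff (E_poly k r) (Suc i) = int (M choose i) * 2 ^ i" if "i \<le> M" for i
    using that by (simp add: E_poly_def M_def coeff_linear_poly_power)
  have nonneg: "nonneg_poly (E_poly k r)"
    unfolding E_poly_def by (intro nonneg_poly_mult nonneg_poly_power) auto
  have "degree (E_poly k r) = Suc M"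
  proof (rule antisym)
    show "degree (E_poly k r) \<le> Suc M"
      using degree_mult_le[of "[:0, 1:]" "[:1, 2::int:] ^ M"] top1_linear_power[of 2 M]
      by (simp add: E_poly_def M_def top1_def del: mult_pCons_left)
    show "Suc M \<le> degree (E_poly k r)" by (rule le_degree) (simp add: c)
  qed
  moreover have step: "(int j + 1) * coeff (E_poly k r) (Suc (Suc j)) = 2 * (int M - int j) * coeff (E_poly k r) (Suc j)"
    if "j < M" for j
  proof -
    have "Suc j * (M choose Suc j) = (M - j) * (M choose j)"
      using binomial_absorb_comp[of M j] binomial_absorption[of j M] by simp
    then have "int (Suc j) * int (M choose Suc j) = (int M - int j) * int (M choose j)"
      using that by (metis of_nat_mult of_nat_diff less_imp_le)
    note absorb = this
    have "(int j + 1) * coeff (E_poly k r) (Suc (Suc j)) = 2 * 2 ^ j * (int (Suc j) * int (M choose Suc j))"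
      using that by (simp add: c)
    also note absorb
    also have "2 * 2 ^ j * ((int M - int j) * int (M choose j)) = 2 * (int M - int j) * coeff (E_poly k r) (Suc j)"
      using that by (simp add: c)
    finally show ?thesis .
  qed
  moreover have "coeff (E_poly k r) i \<le> coeff (E_poly k r) (i + 1)" if "i < m" for i
  proof (cases i)
    case 0
    then show ?thesis using c0 nonneg_polyD[OF nonneg] by simp
  next
    case (Suc j)
    have j: "3 * j + 2 \<le> 2 * M" using that Suc by (simp add: m_def)
    have "(int j + 1) * coeff (E_poly k r) i \<le> 2 * (int M - int j) * coeff (E_poly k r) i"
      using j by (intro mult_right_mono nonneg_polyD[OF nonneg]) (simp add: algebra_simps)
    also have "\<dots> = (int j + 1) * coeff (E_poly k r) (i + 1)" using step[of j] j Suc by simp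
    finally show ?thesis by (simp add: mult_le_cancel_left)
  qed
  moreover have "coeff (E_poly k r) (i + 1) \<le> coeff (E_poly k r) i" if mi: "m \<le> i" "i < Suc M" for i
  proof -
    have "1 \<le> m" by (simp add: m_def M_def)
    then obtain j where i: "i = Suc j" using mi(1) by (cases i) auto
    have j: "2 * M \<le> 3 * j + 1" using mi(1) unfolding i m_def by linarith
    have "(int j + 1) * coeff (E_poly k r) (i + 1) = 2 * (int M - int j) * coeff (E_poly k r) i"
      using step[of j] mi i by simp
    also have "\<dots> \<le> (int j + 1) * coeff (E_poly k r) i"
      using j by (intro mult_right_mono nonneg_polyD[OF nonneg]) (simp add: algebra_simps)
    finally show ?thesis by (simp add: mult_le_cancel_left)
  qed
  moreover have "m = (4 * k + 2 * r + 10) div 3" by (simp add: m_def M_def algebra_simps)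
  moreover have "m \<le> Suc M" by (simp add: m_def)
  ultimately show ?thesis
    unfolding unimodal_with_mode_def using nonneg_polyD[OF nonneg] by auto
qed

lemma check_all_0: "check_all 0" by code_simp
lemma check_all_1: "check_all 1" by code_simp
lemma check_all_2: "check_all 2" by code_simp

lemma shape_ok_if:
  assumes "r \<in> {0, 1, 2}" "3 \<le> k" "r = 2 \<Longrightarrow> 4 \<le> k"
  shows "shape_ok k r"
proof -
  have c: "check_all r" using assms(1) check_all_0 check_all_1 check_all_2 by auto
  have r: "r \<le> 2" using assms(1) by auto
  show ?thesis
  proof (cases "k < 24")
    case True
    then show ?thesis using check_all_correct(1)[OF c] assms by blast
  next
    case False
    then show ?thesis using dominated_ge[OF check_all_correct(2)[OF c]] shape_ok_large r by simp
  qed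
qed

theorem corollary4p11:
  fixes k r \<alpha> :: nat
  assumes "r \<in> {0, 1, 2}"
    and "3 \<le> k" and "k \<le> 400"
    and "r = 2 \<Longrightarrow> 4 \<le> k"
    and "\<alpha> = 2 * k + r + 6"
  shows "independence_number (U_graph k r) = \<alpha> \<and>
    ((\<forall>j. 1 \<le> j \<and> j \<le> \<alpha> - 2 \<longrightarrow> log_concave_at (independence_poly (U_graph k r)) j) \<and>
     \<not> log_concave_at (independence_poly (U_graph k r)) (\<alpha> - 1)) \<and>
    log_concave (H_poly k r) \<and>
    unimodal_with_mode (H_poly k r) ((4 * k + 2 * r + 8) div 3) \<and>
    unimodal_with_mode (E_poly k r) ((4 * k + 2 * r + 10) div 3) \<and>
    unimodal_with_mode (independence_poly (U_graph k r)) ((4 * k + 2 * r + 9) div 3)"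
proof -
  have k: "k \<ge> 1" using assms(2) by simp
  have shape_ok: "shape_ok k r" using assms by (intro shape_ok_if)
  have H: "coeff (H_poly k r) = H_coeff k r"
    unfolding H_coeff_def H_poly_eq[OF k] ..
  have U: "coeff (independence_poly (U_graph k r)) = U_coeff k r"
    unfolding U_coeff_def independence_poly_U(1)[OF k] ..
  note Hc = coeff_main_plus_rest[OF k ulc_F4 degree_F4_FU(1), where r = r, folded H_poly_eq[OF k], unfolded H]
  note Uc = coeff_main_plus_rest[OF k ulc_FU degree_F4_FU(2), where r = r, folded independence_poly_U(1)[OF k], unfolded U]
  have Hlc: "H_coeff k r (j - 1) * H_coeff k r (j + 1) \<le> (H_coeff k r j)\<^sup>2" if "1 \<le> j" "j < \<alpha>" for j
    using shape_ok that assms(5) by (simp add: shape_ok_def)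
  have Ulc: "U_coeff k r (j - 1) * U_coeff k r (j + 1) \<le> (U_coeff k r j)\<^sup>2" if "1 \<le> j" "j < \<alpha> - 1" for j
    using shape_ok that assms(5) by (simp add: shape_ok_def)
  have Ufail: "\<not> U_coeff k r (\<alpha> - 1 - 1) * U_coeff k r (\<alpha> - 1 + 1) \<le> (U_coeff k r (\<alpha> - 1))\<^sup>2"
  proof -
    have "\<alpha> - 1 - 1 = 2 * k + r + 4" "\<alpha> - 1 + 1 = 2 * k + r + 6" "\<alpha> - 1 = 2 * k + r + 5"
      using assms(5) by simp_all
    then show ?thesis using shape_ok unfolding shape_ok_def by (simp only:) blast
  qed
  have m: "1 \<le> H_mode k r" "H_mode k r < \<alpha>" "1 \<le> U_mode k r" "U_mode k r < \<alpha> - 1"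
    using assms(5) by (auto simp: H_mode_def U_mode_def)
  have Hpos: "0 < H_coeff k r j" if "j \<le> \<alpha>" for j using Hc(2)[of j] that assms(5) by simp
  have Upos: "0 < U_coeff k r j" if "j \<le> \<alpha>" for j using Uc(2)[of j] that assms(5) by simp
  have "log_concave (H_poly k r)"
    unfolding log_concave_def log_concave_at_def H using Hc(1,3) Hlc assms(5) by auto
  moreover have "unimodal_with_mode (H_poly k r) (H_mode k r)"
    unfolding unimodal_with_mode_def H Hc(1)
    using unimodal_if_log_concave_peak[of \<alpha> "H_coeff k r" "H_mode k r"] Hpos Hlc shape_ok m Hc(3) assms(5)
    by (auto simp: shape_ok_def)
  moreover have "unimodal_with_mode (independence_poly (U_graph k r)) (U_mode k r)"
  proof -
    \<comment> \<open>This descent is out of reach of log-concavity, but the final coefficient is 1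
      and its predecessor is a positive integer.\<close>
    have last: "U_coeff k r (i + 1) \<le> U_coeff k r i" if "i = \<alpha> - 1" for i
    proof -
      have "i + 1 = 2 * k + r + 6" using that assms(5) by simp
      then have "U_coeff k r (i + 1) = 1" using Uc(4) by (simp only:)
      moreover have "0 < U_coeff k r i" using that by (intro Upos) simp
      ultimately show ?thesis by simp
    qed
    have pos: "0 < U_coeff k r j" if "j \<le> \<alpha> - 1" for j using that by (intro Upos) simp
    have peak: "peak_at (U_coeff k r) (U_mode k r)" using shape_ok by (simp add: shape_ok_def)
    note uni = unimodal_if_log_concave_peak[OF pos Ulc peak m(3,4)]
    have "U_coeff k r (i + 1) \<le> U_coeff k r i" if "U_mode k r \<le> i" "i < \<alpha>" for i
      using uni(2)[of i] last[of i] that by (cases "i = \<alpha> - 1") auto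
    then show ?thesis
      unfolding unimodal_with_mode_def U Uc(1) using uni(1) Uc(3) m assms(5) by auto
  qed
  moreover have "log_concave_at (independence_poly (U_graph k r)) j" if "1 \<le> j \<and> j \<le> \<alpha> - 2" for j
    unfolding log_concave_at_def U using Ulc that assms(5) by simp
  moreover have "\<not> log_concave_at (independence_poly (U_graph k r)) (\<alpha> - 1)"
    unfolding log_concave_at_def U by (rule Ufail)
  moreover have "independence_number (U_graph k r) = \<alpha>"
    using independence_poly_U(2)[OF k] Uc(1) assms(5) by simp
  ultimately show ?thesis
    unfolding H_mode_def U_mode_def using E_poly_unimodal[of k r] by blast
qed

end
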